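(* There is a polynomial-time algorithm that, given a graph $G$, decides whether $G$ is isomorphic to a letter graph $G(\mathcal{P},w)$ for the alphabet $\{a,b,c\}$, the decoder $\mathcal{P}=\{(a,b),(b,c),(c,a)\}$ and some word $w$ over $\{a,b,c\}$.
   Context: For a finite alphabet $\Sigma$, a decoder $\mathcal{P}\subseteq\Sigma^2$ (set of ordered pairs) and a word $w=w_1\cdots w_n$ over $\Sigma$, the letter graph $G(\mathcal{P},w)$ has vertex set $\{1,\dots,n\}$, with $i<j$ adjacent iff $(w_i,w_j)\in\mathcal{P}$. *)

theory Defs
  imports
    "Graph_Theory.Graph_Theory"
    "HOL-Computational_Algebra.Polynomial"
begin

section \<open>Letter graphs\<close>

text \<open>
  A finite simple graph is a \<^const>\<open>pair_graph\<close>: finite, loop-free, and with a symmetric arc set,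
  each edge being represented by its two arcs. Positions of a word are counted from 1, so the
  letter at position \<open>i\<close> is \<open>w ! (i - 1)\<close>.
\<close>

definition letter_graph :: "('s \<times> 's) set \<Rightarrow> 's list \<Rightarrow> nat pair_pre_digraph" where
  "letter_graph P w =
     \<lparr> pverts = {1..length w},
       parcs = {(i, j). i \<in> {1..length w} \<and> j \<in> {1..length w} \<and>
                  (i < j \<and> (w ! (i - 1), w ! (j - 1)) \<in> P \<or>
                   j < i \<and> (w ! (j - 1), w ! (i - 1)) \<in> P)} \<rparr>"

lemma pair_graph_letter_graph: "pair_graph (letter_graph P w)"
proof
  show "finite (parcs (letter_graph P w))"
    by (rule finite_subset[of _ "{1..length w} \<times> {1..length w}"]) (auto simp: letter_graph_def)
  show "symmetric (with_proj (letter_graph P w))"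
    by (auto simp: symmetric_def letter_graph_def intro!: symI)
qed (auto simp: letter_graph_def)

datatype letter = ltr_a | ltr_b | ltr_c

definition cyclic_decoder :: "(letter \<times> letter) set" where
  "cyclic_decoder = {(ltr_a, ltr_b), (ltr_b, ltr_c), (ltr_c, ltr_a)}"

section \<open>Deterministic multi-tape Turing machines\<close>

text \<open>
  States are the numbers below \<open>states\<close>, tape symbols the numbers below \<open>symbols\<close>, and 0 is the
  blank. Tapes are infinite in both directions; a tape is a pair of its contents and its head
  position. The machine halts upon entering its accepting or its rejecting state.
\<close>

datatype move = Move_Left | Move_None | Move_Right

record tm =
  tapes :: nat
  symbols :: nat
  states :: nat
  start :: nat
  accept :: nat
  reject :: nat
  delta :: "nat \<Rightarrow> nat list \<Rightarrow> nat \<times> (nat \<times> move) list"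

definition wf_tm :: "tm \<Rightarrow> bool" where
  "wf_tm M \<longleftrightarrow>
     1 \<le> tapes M \<and> 1 \<le> symbols M \<and>
     start M < states M \<and> accept M < states M \<and> reject M < states M \<and> accept M \<noteq> reject M \<and>
     (\<forall>q < states M. \<forall>ss. length ss = tapes M \<and> set ss \<subseteq> {..<symbols M} \<longrightarrow>
        (case delta M q ss of (q', as) \<Rightarrow>
           q' < states M \<and> length as = tapes M \<and> fst ` set as \<subseteq> {..<symbols M}))"

type_synonym tape = "(int \<Rightarrow> nat) \<times> int"
type_synonym config = "nat \<times> tape list"

fun tape_act :: "nat \<times> move \<Rightarrow> tape \<Rightarrow> tape" where
  "tape_act (s, m) (f, h) =
     (f(h := s), case m of Move_Left \<Rightarrow> h - 1 | Move_None \<Rightarrow> h | Move_Right \<Rightarrow> h + 1)"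

fun tm_step :: "tm \<Rightarrow> config \<Rightarrow> config" where
  "tm_step M (q, ts) =
     (if q = accept M \<or> q = reject M then (q, ts)
      else case delta M q (map (\<lambda>(f, h). f h) ts) of (q', as) \<Rightarrow> (q', map2 tape_act as ts))"

definition input_tape :: "nat list \<Rightarrow> tape" where
  "input_tape x = (\<lambda>i. if 0 \<le> i \<and> i < int (length x) then x ! nat i else 0, 0)"

definition tm_init :: "tm \<Rightarrow> nat list \<Rightarrow> config" where
  "tm_init M x = (start M, input_tape x # replicate (tapes M - 1) (\<lambda>_. 0, 0))"

definition tm_run :: "tm \<Rightarrow> nat list \<Rightarrow> nat \<Rightarrow> config" where
  "tm_run M x t = (tm_step M ^^ t) (tm_init M x)"

text \<open>
  The instances in \<open>I\<close>, written down by \<open>enc\<close> as words without blanks, are decided with respect to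
  the property \<open>Q\<close> in time polynomial in the length of the input word. Since halting
  configurations are fixed points of the step function, having the right verdict after exactly
  \<open>poly p n\<close> steps means having reached it within that many steps.
\<close>

definition polytime_decidable :: "('i \<Rightarrow> nat list) \<Rightarrow> 'i set \<Rightarrow> ('i \<Rightarrow> bool) \<Rightarrow> bool" where
  "polytime_decidable enc I Q \<longleftrightarrow>
     (\<exists>(M :: tm) (p :: nat poly). wf_tm M \<and>
        (\<forall>x \<in> I. set (enc x) \<subseteq> {1..<symbols M} \<and>
           fst (tm_run M (enc x) (poly p (length (enc x)))) =
             (if Q x then accept M else reject M)))"

section \<open>Graphs as input words\<close>

text \<open>
  The adjacency matrix of \<open>G\<close> with respect to a listing \<open>vs\<close> of its vertices, row by row: symbol 1
  for a non-adjacent pair, 2 for an adjacent pair, and 3 at the end of every row.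
\<close>

definition graph_presentations :: "(nat pair_pre_digraph \<times> nat list) set" where
  "graph_presentations = {(G, vs). pair_graph G \<and> distinct vs \<and> set vs = pverts G}"

fun adjacency_word :: "nat pair_pre_digraph \<times> nat list \<Rightarrow> nat list" where
  "adjacency_word (G, vs) =
     concat (map (\<lambda>u. map (\<lambda>v. if (u, v) \<in> parcs G then 2 else 1) vs @ [3]) vs)"

end

theory Submission
  imports Defs "HOL-Library.Sublist" "HOL-Library.Infinite_Set" "HOL-Library.Nat_Bijection"
begin

text \<open>
  Polynomial-time decidability follows from the existence of a finite list of minimal forbidden
  induced subgraphs. A minimal non-letter-graph becomes a letter graph when a vertex is deleted, so
  it is encoded by a word over a finite alphabet, and Higman's lemma leaves room for only finitely
  many of them. Hence for some constant \<open>k\<close> a graph is a letter graph iff each of its \<open>k\<close>-tuples of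
  vertices induces one, which a Turing machine checks by running through all tuples. The bound \<open>k\<close>
  is obtained non-constructively.
\<close>

section \<open>Higman's lemma\<close>

text \<open>Subword embeddings compare letter graphs, whereas an obstruction is precisely not a
  letter graph. Recording next to each letter the adjacency to one deleted vertex bridges this gap
  at the price of a doubled alphabet. What results is a bound on the number of vertices, so the test
  ranges over all maps from \<open>{..<k}\<close> to the vertices, repetitions included;
  realizability therefore has to survive pulling back along maps that are not injective. The test is
  polynomial because k is constant: there are n^k tuples, and the adjacency pattern of a tuple is
  one of finitely many sets of pairs. The machine collects this pattern in its state during one pass
  over the matrix, and the verdict on every pattern is built into the transition function. So k and
  the table of verdicts only have to exist.\<close>

definition bad_sequence :: "'a set \<Rightarrow> (nat \<Rightarrow> 'a list) \<Rightarrow> bool" where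
  "bad_sequence A f \<longleftrightarrow> (\<forall>i. set (f i) \<subseteq> A) \<and> (\<forall>i j. i < j \<longrightarrow> \<not> subseq (f i) (f j))"

text \<open>Dependent choice yields bad sequences \<open>F n\<close>, each of least length at
  position n among those agreeing with it below n, where \<open>F (Suc n)\<close> keeps the entries
  up to n. The diagonal inherits badness because a violation involves two entries only, and both
  occur in a single \<open>F j\<close>.\<close>

lemma minimal_bad_sequence:
  assumes "bad_sequence A f"
  obtains m where "bad_sequence A m"
    and "\<forall>g n. bad_sequence A g \<and> (\<forall>i<n. g i = m i) \<longrightarrow> length (m n) \<le> length (g n)"
proof -
  let ?P = "\<lambda>n f. bad_sequence A f \<and>
    (\<forall>g. bad_sequence A g \<and> (\<forall>i<n. g i = f i) \<longrightarrow> length (f n) \<le> length (g n))"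
  let ?Q = "\<lambda>n f f'. \<forall>i\<le>n. f' i = (f i :: 'a list)"
  have least: "\<exists>g. ?P n g \<and> (\<forall>i<n. g i = h i)" if "bad_sequence A h" for n h
  proof -
    have "\<exists>g. (bad_sequence A g \<and> (\<forall>i<n. g i = h i)) \<and>
      (\<forall>g'. bad_sequence A g' \<and> (\<forall>i<n. g' i = h i) \<longrightarrow> length (g n) \<le> length (g' n))"
      by (rule ex_has_least_nat[where k = h and m = "\<lambda>g. length (g n)"]) (use that in auto)
    then obtain g where g: "bad_sequence A g" "\<forall>i<n. g i = h i"
      "\<And>g'. bad_sequence A g' \<Longrightarrow> \<forall>i<n. g' i = h i \<Longrightarrow> length (g n) \<le> length (g' n)"
      by blast
    then show ?thesis by (intro exI[of _ g]) auto
  qed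
  have "\<exists>F. \<forall>n. ?P n (F n) \<and> ?Q n (F n) (F (Suc n))"
  proof (rule dependent_nat_choice)
    show "\<exists>f. ?P 0 f" using least[OF assms, of 0] by blast
    show "\<exists>f'. ?P (Suc n) f' \<and> ?Q n f f'" if "?P n f" for f n
    proof -
      obtain g where "?P (Suc n) g" "\<forall>i<Suc n. g i = f i"
        using least[of f "Suc n"] \<open>?P n f\<close> by blast
      then show ?thesis by (intro exI[of _ g]) auto
    qed
  qed
  then obtain F where F: "\<And>n. ?P n (F n)" "\<And>n. ?Q n (F n) (F (Suc n))" by blast
  have stable: "F (i + d) i = F i i" for i d
    by (induction d) (use F(2) in auto)
  have diag: "F n i = F i i" if "i \<le> n" for n i
    using stable[of i "n - i"] that by simp
  show ?thesis
  proof (rule that[of "\<lambda>n. F n n"])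
    show "bad_sequence A (\<lambda>n. F n n)"
      unfolding bad_sequence_def
    proof (intro conjI allI impI)
      show "set (F i i) \<subseteq> A" for i
        using F(1)[of i] by (simp add: bad_sequence_def)
      show "\<not> subseq (F i i) (F j j)" if "i < j" for i j
      proof -
        have "bad_sequence A (F j)" using F(1) by blast
        then have "\<not> subseq (F j i) (F j j)" using that by (simp add: bad_sequence_def)
        then show ?thesis using diag[of i j] that by simp
      qed
    qed
    have "length (F n n) \<le> length (g n)" if "bad_sequence A g" "\<forall>i<n. g i = F i i" for g n
    proof -
      have "g i = F n i" if "i < n" for i
        using diag[of i n] that \<open>\<forall>i<n. g i = F i i\<close> by simp
      then show ?thesis using F(1)[of n] that(1) by blast
    qed
    then show "\<forall>g n. bad_sequence A g \<and> (\<forall>i<n. g i = F i i) \<longrightarrow> length (F n n) \<le> length (g n)"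
      by blast
  qed
qed

text \<open>Nash-Williams' argument: infinitely many words of a minimal bad sequence share their
  first letter, and dropping that letter from them would give a smaller bad sequence.\<close>

theorem higman:
  fixes f :: "nat \<Rightarrow> 'a list"
  assumes "finite A" and words: "\<And>i. set (f i) \<subseteq> A"
  shows "\<exists>i j. i < j \<and> subseq (f i) (f j)"
proof (rule ccontr)
  assume "\<not> ?thesis"
  then have "bad_sequence A f"
    using words by (auto simp: bad_sequence_def)
  then obtain m where bad: "bad_sequence A m"
    and minimal: "\<forall>g n. bad_sequence A g \<and> (\<forall>i<n. g i = m i) \<longrightarrow> length (m n) \<le> length (g n)"
    by (rule minimal_bad_sequence)
  have nonempty: "m n \<noteq> []" for n
  proof
    assume "m n = []"
    then have "subseq (m n) (m (Suc n))" by simp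
    with bad show False unfolding bad_sequence_def by blast
  qed
  have "\<exists>a\<in>A. infinite {n \<in> UNIV. hd (m n) = a}"
  proof (rule pigeonhole_infinite_rel)
    show "\<forall>n\<in>UNIV. \<exists>a\<in>A. hd (m n) = a"
      using bad hd_in_set[OF nonempty] by (auto simp: bad_sequence_def)
  qed (use assms(1) in auto)
  then obtain a where inf: "infinite {n. hd (m n) = a}" by auto
  define s where "s = enumerate {n. hd (m n) = a}"
  have s: "strict_mono s" and head: "hd (m (s i)) = a" for i
    using inf strict_mono_enumerate[OF inf] enumerate_in_set[OF inf, of i] by (auto simp: s_def)
  define t where "t i = tl (m (s i))" for i
  have cons: "m (s i) = a # t i" for i
    using nonempty[of "s i"] head[of i] by (cases "m (s i)") (auto simp: t_def)
  \<comment> \<open>Keep the entries before the first word starting with \<open>a\<close>, then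
    continue with the shortened words. Any embedding between entries of \<open>g\<close> lifts to
    \<open>m\<close> once the letter \<open>a\<close> is restored.\<close>
  define g where "g i = (if i < s 0 then m i else t (i - s 0))" for i
  have "bad_sequence A g"
    unfolding bad_sequence_def
  proof (intro conjI allI impI)
    show "set (g i) \<subseteq> A" for i
    proof (cases "i < s 0")
      case False
      have "set (t (i - s 0)) \<subseteq> set (m (s (i - s 0)))" by (auto simp: cons)
      then show ?thesis using False bad by (auto simp: bad_sequence_def g_def)
    qed (use bad in \<open>simp add: bad_sequence_def g_def\<close>)
    show "\<not> subseq (g i) (g j)" if "i < j" for i j
    proof
      assume sub: "subseq (g i) (g j)"
      consider "j < s 0" | "i < s 0" "s 0 \<le> j" | "s 0 \<le> i" using \<open>i < j\<close> by linarith
      then show False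
      proof cases
        case 1
        then show False using sub bad \<open>i < j\<close> by (auto simp: g_def bad_sequence_def)
      next
        case 2
        then have "subseq (m i) (t (j - s 0))" using sub by (simp add: g_def)
        then have "subseq (m i) (m (s (j - s 0)))" by (simp add: cons list_emb_Cons)
        moreover have "i < s (j - s 0)"
          using 2 strict_mono_less_eq[OF s, of 0 "j - s 0"] by simp
        ultimately show False using bad by (auto simp: bad_sequence_def)
      next
        case 3
        then have "subseq (t (i - s 0)) (t (j - s 0))"
          using sub \<open>i < j\<close> by (simp add: g_def)
        then have "subseq (m (s (i - s 0))) (m (s (j - s 0)))"
          by (simp add: cons)
        moreover have "s (i - s 0) < s (j - s 0)"
          using s 3 \<open>i < j\<close> by (simp add: strict_mono_less)
        ultimately show False using bad by (auto simp: bad_sequence_def)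
      qed
    qed
  qed
  moreover have "\<forall>i<s 0. g i = m i" by (simp add: g_def)
  ultimately have "length (m (s 0)) \<le> length (g (s 0))" using minimal by blast
  moreover have "length (m (s 0)) = Suc (length (g (s 0)))"
    by (simp add: g_def cons)
  ultimately show False by simp
qed

section \<open>Letter graphs have finitely many minimal obstructions\<close>

text \<open>
  Distinct vertices may share a rank if they carry the same letter. For an irreflexive decoder this
  does not enlarge the class of finite graphs, and it makes the notion stable under pulling back
  along arbitrary maps, see \<open>realizable_pullback\<close>.
\<close>

definition realizable :: "('s \<times> 's) set \<Rightarrow> 'v set \<Rightarrow> ('v \<Rightarrow> 'v \<Rightarrow> bool) \<Rightarrow> bool" where
  "realizable P V E \<longleftrightarrow> (\<exists>(r :: 'v \<Rightarrow> nat) l. \<forall>u\<in>V. \<forall>v\<in>V. (r u = r v \<longrightarrow> l u = l v) \<and>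
     (E u v \<longleftrightarrow> r u < r v \<and> (l u, l v) \<in> P \<or> r v < r u \<and> (l v, l u) \<in> P))"

text \<open>Compose rank and letter with \<open>f\<close>. An inclusion \<open>f\<close> gives
  restriction to induced subgraphs, a non-injective \<open>f\<close> gives tuples with repeated
  vertices.\<close>

lemma realizable_pullback:
  assumes "realizable P W E'" "f ` V \<subseteq> W" "\<And>u v. u \<in> V \<Longrightarrow> v \<in> V \<Longrightarrow> E u v \<longleftrightarrow> E' (f u) (f v)"
  shows "realizable P V E"
proof -
  obtain r :: "_ \<Rightarrow> nat" and l where rl: "\<And>u v. u \<in> W \<Longrightarrow> v \<in> W \<Longrightarrow> (r u = r v \<longrightarrow> l u = l v) \<and>
     (E' u v \<longleftrightarrow> r u < r v \<and> (l u, l v) \<in> P \<or> r v < r u \<and> (l v, l u) \<in> P)"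
    using assms(1) unfolding realizable_def by blast
  have "(r (f u) = r (f v) \<longrightarrow> l (f u) = l (f v)) \<and>
     (E u v \<longleftrightarrow> r (f u) < r (f v) \<and> (l (f u), l (f v)) \<in> P \<or>
       r (f v) < r (f u) \<and> (l (f v), l (f u)) \<in> P)" if "u \<in> V" "v \<in> V" for u v
    using rl[of "f u" "f v"] assms(2,3) that by blast
  then show ?thesis
    unfolding realizable_def by (intro exI[of _ "\<lambda>u. r (f u)"] exI[of _ "\<lambda>u. l (f u)"]) blast
qed

lemma realizable_cong:
  "(\<And>u v. u \<in> V \<Longrightarrow> v \<in> V \<Longrightarrow> E u v \<longleftrightarrow> E' u v) \<Longrightarrow> realizable P V E \<longleftrightarrow> realizable P V E'"
  by (rule iffI; erule realizable_pullback[where f = id]) auto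

text \<open>Sorting by rank breaks ties arbitrarily. Tied vertices are non-adjacent, and as they
  carry the same letter, irreflexivity of \<open>P\<close> says the same for either order between
  them.\<close>

lemma realizable_listing:
  assumes "realizable P V E" "finite V" "irrefl P"
  obtains xs l where "distinct xs" "set xs = V"
    "sorted_wrt (\<lambda>u v. (E u v \<longleftrightarrow> (l u, l v) \<in> P) \<and> (E v u \<longleftrightarrow> (l u, l v) \<in> P)) xs"
proof -
  obtain r :: "_ \<Rightarrow> nat" and l where rl: "\<And>u v. u \<in> V \<Longrightarrow> v \<in> V \<Longrightarrow> (r u = r v \<longrightarrow> l u = l v) \<and>
     (E u v \<longleftrightarrow> r u < r v \<and> (l u, l v) \<in> P \<or> r v < r u \<and> (l v, l u) \<in> P)"
    using assms(1) unfolding realizable_def by blast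
  obtain ys where ys: "set ys = V" "distinct ys" using finite_distinct_list[OF assms(2)] by blast
  let ?xs = "sort_key r ys"
  have "sorted_wrt (\<lambda>u v. r u \<le> r v) ?xs"
    using sorted_sort_key[of r ys] by (simp add: sorted_map)
  then have "sorted_wrt (\<lambda>u v. (E u v \<longleftrightarrow> (l u, l v) \<in> P) \<and> (E v u \<longleftrightarrow> (l u, l v) \<in> P)) ?xs"
  proof (rule sorted_wrt_mono_rel[rotated])
    fix u v assume "u \<in> set ?xs" "v \<in> set ?xs" "r u \<le> r v"
    then show "(E u v \<longleftrightarrow> (l u, l v) \<in> P) \<and> (E v u \<longleftrightarrow> (l u, l v) \<in> P)"
      using rl[of u v] rl[of v u] ys assms(3)
      by (cases "r u = r v") (auto simp: irrefl_def)
  qed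
  then show ?thesis using that[of ?xs l] ys by simp
qed

lemma sorted_wrt_nths: "sorted_wrt R xs \<Longrightarrow> sorted_wrt R (nths xs I)"
  by (induction xs arbitrary: I) (auto simp: nths_Cons dest: in_set_nthsD)

definition minimal_obstruction :: "('s \<times> 's) set \<Rightarrow> 'v set \<Rightarrow> ('v \<Rightarrow> 'v \<Rightarrow> bool) \<Rightarrow> bool" where
  "minimal_obstruction P V E \<longleftrightarrow> finite V \<and> irreflp E \<and> symp E \<and> \<not> realizable P V E \<and>
     (\<forall>W. W \<subset> V \<longrightarrow> realizable P W E)"

text \<open>
  Deleting a vertex \<open>v\<close> from a minimal obstruction leaves a letter graph, so the obstruction is
  encoded by a word over pairs of a letter and the adjacency to \<open>v\<close>. Subwords encode
  induced subgraphs, so Higman's lemma finds, in any infinite sequence of minimal obstructions of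
  increasing size, one that contains an earlier one properly.
\<close>

definition coded_obstruction ::
    "('s \<times> 's) set \<Rightarrow> 'v set \<Rightarrow> ('v \<Rightarrow> 'v \<Rightarrow> bool) \<Rightarrow> 'v \<Rightarrow> 'v list \<Rightarrow> ('v \<Rightarrow> 's) \<Rightarrow> bool" where
  "coded_obstruction P V E v xs l \<longleftrightarrow> minimal_obstruction P V E \<and> v \<in> V \<and> distinct xs \<and>
     set xs = V - {v} \<and> sorted_wrt (\<lambda>u w. E u w \<longleftrightarrow> (l u, l w) \<in> P) xs"

lemma coded_obstruction_exists:
  assumes "minimal_obstruction P V E" "irrefl P"
  shows "\<exists>v xs l. coded_obstruction P V E v xs l"
proof -
  from assms have obstr: "finite V" "\<not> realizable P V E" "\<And>W. W \<subset> V \<Longrightarrow> realizable P W E"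
    unfolding minimal_obstruction_def by auto
  \<comment> \<open>The empty vertex set is realizable, so there is a vertex to delete.\<close>
  then obtain v where v: "v \<in> V" by (force simp: realizable_def)
  then have "realizable P (V - {v}) E" using obstr by blast
  then obtain xs l where "distinct xs" "set xs = V - {v}"
    "sorted_wrt (\<lambda>u v. (E u v \<longleftrightarrow> (l u, l v) \<in> P) \<and> (E v u \<longleftrightarrow> (l u, l v) \<in> P)) xs"
    by (rule realizable_listing) (use obstr assms in auto)
  moreover from this(3) have "sorted_wrt (\<lambda>u w. E u w \<longleftrightarrow> (l u, l w) \<in> P) xs"
    by (rule sorted_wrt_mono_rel[rotated]) simp
  ultimately show ?thesis using assms(1) v unfolding coded_obstruction_def by blast
qed

text \<open>The subword embedding, extended by sending \<open>v\<close> to \<open>v'\<close>,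
  preserves and reflects adjacency. If \<open>V'\<close> were larger than \<open>V\<close>, the
  image would be a proper subset of \<open>V'\<close>, hence realizable by minimality, and pulling
  back would realize \<open>V\<close>.\<close>

lemma coded_obstruction_subseq:
  assumes code: "coded_obstruction P V E v xs l" "coded_obstruction P V' E' v' ys l'"
    and sub: "subseq (map (\<lambda>u. (l u, E v u)) xs) (map (\<lambda>u. (l' u, E' v' u)) ys)"
  shows "card V' \<le> card V"
proof (rule ccontr)
  assume less: "\<not> card V' \<le> card V"
  have obstr: "minimal_obstruction P V E" "minimal_obstruction P V' E'"
    and v: "v \<in> V" and xs: "distinct xs" "set xs = V - {v}"
      "sorted_wrt (\<lambda>u w. E u w \<longleftrightarrow> (l u, l w) \<in> P) xs"
    and v': "v' \<in> V'" and ys: "set ys = V' - {v'}"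
      "sorted_wrt (\<lambda>u w. E' u w \<longleftrightarrow> (l' u, l' w) \<in> P) ys"
    using code by (simp_all add: coded_obstruction_def)
  have props: "finite V" "irreflp E" "symp E" "\<not> realizable P V E"
    "finite V'" "irreflp E'" "symp E'" "\<And>W. W \<subset> V' \<Longrightarrow> realizable P W E'"
    using obstr by (auto simp: minimal_obstruction_def)
  obtain N where "map (\<lambda>u. (l u, E v u)) xs = nths (map (\<lambda>u. (l' u, E' v' u)) ys) N"
    using sub subseq_conv_nths by blast
  moreover define zs where "zs = nths ys N"
  ultimately have zs: "map (\<lambda>u. (l u, E v u)) xs = map (\<lambda>u. (l' u, E' v' u)) zs"
    by (simp add: nths_map)
  from zs have len: "length xs = length zs" by (metis length_map)
  have nth: "l (xs ! a) = l' (zs ! a)" "E v (xs ! a) = E' v' (zs ! a)" if "a < length xs" for a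
    using arg_cong[OF zs, of "\<lambda>t. t ! a"] that len by auto
  have zs_sub: "set zs \<subseteq> V' - {v'}"
    using ys(1) set_nths_subset[of ys N] by (simp add: zs_def)
  have zs_sorted: "sorted_wrt (\<lambda>u w. E' u w \<longleftrightarrow> (l' u, l' w) \<in> P) zs"
    using ys(2) by (simp add: zs_def sorted_wrt_nths)
  have less_iff: "E (xs ! a) (xs ! b) \<longleftrightarrow> E' (zs ! a) (zs ! b)" if "a < b" "b < length xs" for a b
    using sorted_wrt_nth_less[OF xs(3) that] sorted_wrt_nth_less[OF zs_sorted that(1)] nth that len
    by auto
  have nth_iff: "E (xs ! a) (xs ! b) \<longleftrightarrow> E' (zs ! a) (zs ! b)"
    if "a < length xs" "b < length xs" for a b
  proof (cases a b rule: linorder_cases)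
    case greater
    then show ?thesis using less_iff[of b a] that props by (meson sympD)
  qed (use less_iff that props in \<open>auto dest: irreflpD\<close>)
  define idx where "idx u = (THE a. a < length xs \<and> xs ! a = u)" for u
  have idx: "idx (xs ! a) = a" if "a < length xs" for a
    unfolding idx_def using that xs(1) by (auto intro!: the_equality simp: nth_eq_iff_index_eq)
  define f where "f u = (if u = v then v' else zs ! idx u)" for u
  have f_v: "f v = v'" by (simp add: f_def)
  have f_nth: "f (xs ! a) = zs ! a" if "a < length xs" for a
    using that xs(2) nth_mem[OF that] by (auto simp: f_def idx)
  have V_cases: "u = v \<or> (\<exists>a<length xs. u = xs ! a)" if "u \<in> V" for u
    using that xs(2) by (metis DiffI in_set_conv_nth singletonD)
  have hom: "E u w \<longleftrightarrow> E' (f u) (f w)" if "u \<in> V" "w \<in> V" for u w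
  proof -
    have irr: "\<not> E v v" "\<not> E' v' v'"
      and sym: "E a b \<longleftrightarrow> E b a" "E' c d \<longleftrightarrow> E' d c" for a b c d
      using props by (auto dest: irreflpD sympD)
    show ?thesis
      using V_cases[OF that(1)] V_cases[OF that(2)] irr sym nth(2) nth_iff f_v f_nth by fastforce
  qed
  have "f ` V \<subseteq> V'"
    using V_cases f_v f_nth v' zs_sub len nth_mem by (metis DiffD1 image_subsetI subsetD)
  moreover have "card (f ` V) \<le> card V" using props by (simp add: card_image_le)
  ultimately have "f ` V \<subset> V'" using less by auto
  then have "realizable P (f ` V) E'" using props by blast
  then have "realizable P V E" by (rule realizable_pullback) (use hom in auto)
  then show False using props by blast
qed

text \<open>Working with the set of sizes lets \<open>enumerate\<close> supply a strictly increasing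
  sequence, which contradicts \<open>coded_obstruction_subseq\<close> at the pair found by Higman's
  lemma.\<close>

lemma minimal_obstructions_bounded:
  fixes P :: "('s::finite \<times> 's) set"
  assumes "irrefl P"
  obtains k where "\<And>(V :: 'v set) E. minimal_obstruction P V E \<Longrightarrow> card V \<le> k"
proof -
  let ?C = "{card V | V. \<exists>E :: 'v \<Rightarrow> 'v \<Rightarrow> bool. minimal_obstruction P V E}"
  have "finite ?C"
  proof (rule ccontr)
    assume inf: "infinite ?C"
    let ?s = "enumerate ?C"
    have mem: "?s n \<in> ?C" for n using enumerate_in_set[OF inf] by blast
    have "\<forall>n. \<exists>(V :: 'v set) E v xs l. card V = ?s n \<and> coded_obstruction P V E v xs l"
    proof
      fix n
      obtain V and E :: "'v \<Rightarrow> 'v \<Rightarrow> bool" where "minimal_obstruction P V E" "card V = ?s n"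
        using mem[of n] by auto
      then show "\<exists>(V :: 'v set) E v xs l. card V = ?s n \<and> coded_obstruction P V E v xs l"
        using coded_obstruction_exists[OF _ assms] by blast
    qed
    then obtain V :: "nat \<Rightarrow> 'v set" and E v xs l where card: "\<And>n. card (V n) = ?s n"
      and code: "\<And>n. coded_obstruction P (V n) (E n) (v n) (xs n) (l n)"
      unfolding choice_iff by blast
    have "\<exists>i j. i < j \<and> subseq (map (\<lambda>u. (l i u, E i (v i) u)) (xs i)) (map (\<lambda>u. (l j u, E j (v j) u)) (xs j))"
      \<comment> \<open>The alphabet consists of all pairs of a letter and a truth value, which is
        finite because the type of letters is.\<close>
      by (rule higman[of UNIV]) auto
    then obtain i j where ij: "i < j"
      "subseq (map (\<lambda>u. (l i u, E i (v i) u)) (xs i)) (map (\<lambda>u. (l j u, E j (v j) u)) (xs j))"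
      by blast
    have "card (V j) \<le> card (V i)"
      by (rule coded_obstruction_subseq[OF code code ij(2)])
    moreover have "?s i < ?s j" using ij(1) inf by (simp add: enumerate_mono)
    ultimately show False using card by simp
  qed
  then obtain k where "\<forall>c\<in>?C. c \<le> k" using finite_nat_set_iff_bounded_le by blast
  then show ?thesis using that[of k] by blast
qed

lemma not_realizable_imp_minimal_obstruction:
  assumes "finite V" "irreflp E" "symp E" "\<not> realizable P V E"
  shows "\<exists>W\<subseteq>V. minimal_obstruction P W E"
  using assms
proof (induction V rule: finite_psubset_induct)
  case (psubset V)
  show ?case
  proof (cases "\<exists>W. W \<subset> V \<and> \<not> realizable P W E")
    case True
    then obtain W where "W \<subset> V" "\<not> realizable P W E" by blast
    then show ?thesis using psubset by (meson order.trans psubset_imp_subset)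
  next
    case False
    then show ?thesis using psubset by (auto simp: minimal_obstruction_def)
  qed
qed

text \<open>A non-realizable graph contains a minimal obstruction, which has at most k vertices and
  is therefore the range of some k-tuple.\<close>

theorem realizable_iff_tuples:
  fixes P :: "('s::finite \<times> 's) set"
  assumes "irrefl P"
  obtains k where "0 < k" "\<And>(V :: nat set) E. finite V \<Longrightarrow> irreflp E \<Longrightarrow> symp E \<Longrightarrow>
    realizable P V E \<longleftrightarrow> (\<forall>i. i ` {..<k} \<subseteq> V \<longrightarrow> realizable P {..<k::nat} (\<lambda>p q. E (i p) (i q)))"
proof -
  obtain k' where "\<And>(V :: nat set) E. minimal_obstruction P V E \<Longrightarrow> card V \<le> k'"
    using minimal_obstructions_bounded[OF assms] by blast
  \<comment> \<open>Enlarging the bound is harmless, and a positive k gives the machine a digit to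
    increment.\<close>
  then obtain k where k: "\<And>(V :: nat set) E. minimal_obstruction P V E \<Longrightarrow> card V \<le> k" "0 < k"
    using le_SucI by blast
  show ?thesis
  proof (rule that[of k], rule k(2), rule iffI)
    fix V :: "nat set" and E :: "nat \<Rightarrow> nat \<Rightarrow> bool"
    assume V: "finite V" "irreflp E" "symp E"
    show "\<forall>i. i ` {..<k} \<subseteq> V \<longrightarrow> realizable P {..<k} (\<lambda>p q. E (i p) (i q))" if "realizable P V E"
      using that by (auto intro: realizable_pullback)
    show "realizable P V E"
      if tuples: "\<forall>i. i ` {..<k} \<subseteq> V \<longrightarrow> realizable P {..<k} (\<lambda>p q. E (i p) (i q))"
    proof (rule ccontr)
      assume "\<not> realizable P V E"
      then obtain W where W: "W \<subseteq> V" "minimal_obstruction P W E"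
        using not_realizable_imp_minimal_obstruction[OF V] by blast
      have fin: "finite W" "card W \<le> k" and not: "\<not> realizable P W E"
        using W k(1) by (auto simp: minimal_obstruction_def)
      then obtain w where w: "w \<in> W" by (force simp: realizable_def)
      obtain s where s: "bij_betw s W {..<card W}"
        using finite_same_card_bij[OF fin(1), of "{..<card W}"] by auto
      \<comment> \<open>Entries from \<open>card W\<close> on repeat the vertex \<open>w\<close>.
        Since \<open>i (s u) = u\<close> on \<open>W\<close>, pulling the pattern back along
        \<open>s\<close> recovers the graph on \<open>W\<close>.\<close>
      define i where "i p = (if p < card W then the_inv_into W s p else w)" for p
      have i_s: "i (s u) = u" if "u \<in> W" for u
        using s that by (auto simp: i_def bij_betw_def the_inv_into_f_f)
      have "i ` {..<k} \<subseteq> W"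
        using s w the_inv_into_into[of s W _ W] by (auto simp: i_def bij_betw_def)
      then have "realizable P {..<k} (\<lambda>p q. E (i p) (i q))" using tuples W by blast
      then have "realizable P W E"
        by (rule realizable_pullback[where f = s]) (use s i_s fin in \<open>auto simp: bij_betw_def\<close>)
      then show False using not by blast
    qed
  qed
qed

section \<open>Isomorphism to a letter graph as realizability\<close>

text \<open>An isomorphism supplies positions as ranks and the letters at these positions.
  Conversely, the letters along a listing by rank spell the word.\<close>

lemma realizable_iff_digraph_iso:
  fixes P :: "('s \<times> 's) set"
  assumes "pair_graph G" "irrefl P"
  shows "(\<exists>w. digraph_iso (with_proj G) (with_proj (letter_graph P w))) \<longleftrightarrow>
    realizable P (pverts G) (\<lambda>u v. (u, v) \<in> parcs G)"
proof -
  interpret pair_graph G by fact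
  show ?thesis
  proof
    assume "\<exists>w. digraph_iso (with_proj G) (with_proj (letter_graph P w))"
    then obtain w f where f: "pre_digraph.digraph_isomorphism (with_proj G) f"
      "with_proj (letter_graph P w) = app_iso f (with_proj G)"
      by (auto simp: digraph_iso_def)
    let ?r = "iso_verts f"
    have inj: "inj_on ?r (pverts G)"
      using f(1) by (simp add: pre_digraph.digraph_isomorphism_def)
    \<comment> \<open>Both digraphs have the projections as tail and head, while
      \<open>app_iso\<close> takes these functions from \<open>f\<close>. So they are forced, and
      the vertex map determines the arc map.\<close>
    have ends: "iso_tail f = fst" "iso_head f = snd"
      using arg_cong[OF f(2), of tail] arg_cong[OF f(2), of head] by simp_all
    have verts: "?r ` pverts G = {1..length w}"
      using arg_cong[OF f(2), of verts] by (simp add: letter_graph_def)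
    have arc: "iso_arcs f (u, v) = (?r u, ?r v)" if "(u, v) \<in> parcs G" for u v
      using f(1) that ends by (auto simp: pre_digraph.digraph_isomorphism_def prod_eq_iff)
    have arcs: "parcs (letter_graph P w) = iso_arcs f ` parcs G"
      using arg_cong[OF f(2), of arcs] by simp
    have "(u, v) \<in> parcs G \<longleftrightarrow> (?r u, ?r v) \<in> parcs (letter_graph P w)"
      if uv: "u \<in> pverts G" "v \<in> pverts G" for u v
    proof
      show "(?r u, ?r v) \<in> parcs (letter_graph P w)" if "(u, v) \<in> parcs G"
        using arc[OF that] that arcs by (metis imageI)
      assume "(?r u, ?r v) \<in> parcs (letter_graph P w)"
      then obtain u' v' where e: "(u', v') \<in> parcs G" "iso_arcs f (u', v') = (?r u, ?r v)"
        using arcs by auto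
      then have "?r u' = ?r u" "?r v' = ?r v" using arc by auto
      moreover have "u' \<in> pverts G" "v' \<in> pverts G" using in_arcsD1 in_arcsD2 e(1) by auto
      ultimately show "(u, v) \<in> parcs G" using inj uv e(1) by (metis inj_onD)
    qed
    then show "realizable P (pverts G) (\<lambda>u v. (u, v) \<in> parcs G)"
      unfolding realizable_def letter_graph_def using verts inj
      by (intro exI[of _ ?r] exI[of _ "\<lambda>u. w ! (?r u - 1)"]) (auto dest: inj_onD)
  next
    assume "realizable P (pverts G) (\<lambda>u v. (u, v) \<in> parcs G)"
    then obtain xs l where xs: "distinct xs" "set xs = pverts G"
      "sorted_wrt (\<lambda>u v. ((u, v) \<in> parcs G \<longleftrightarrow> (l u, l v) \<in> P) \<and>
        ((v, u) \<in> parcs G \<longleftrightarrow> (l u, l v) \<in> P)) xs"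
      by (rule realizable_listing) (use assms in auto)
    define f where "f u = Suc (THE a. a < length xs \<and> xs ! a = u)" for u
    have f_nth: "f (xs ! a) = Suc a" if "a < length xs" for a
      unfolding f_def using that xs(1) by (auto intro!: the_equality simp: nth_eq_iff_index_eq)
    have V_cases: "\<exists>a<length xs. u = xs ! a" if "u \<in> pverts G" for u
      using that xs(2) by (metis in_set_conv_nth)
    have inj: "inj_on f (pverts G)"
      by (rule inj_onI) (use V_cases f_nth in \<open>metis Suc_inject\<close>)
    have verts: "f ` pverts G = {1..length xs}"
    proof -
      have "f ` pverts G = f ` (!) xs ` {..<length xs}"
        unfolding xs(2)[symmetric] by (metis image_set map_nth lessThan_atLeast0 set_map set_upt)
      also have "\<dots> = Suc ` {..<length xs}" using f_nth by (force simp: image_image)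
      also have "\<dots> = {1..length xs}" by (simp add: lessThan_atLeast0 image_Suc_atLeastLessThan atLeastLessThanSuc_atLeastAtMost)
      finally show ?thesis .
    qed
    define F where "F = (\<lambda>(u, v). (f u, f v))"
    have edge: "(xs ! a, xs ! b) \<in> parcs G \<longleftrightarrow>
        a < b \<and> (l (xs ! a), l (xs ! b)) \<in> P \<or> b < a \<and> (l (xs ! b), l (xs ! a)) \<in> P"
      if "a < length xs" "b < length xs" for a b
      using sorted_wrt_nth_less[OF xs(3), of a b] sorted_wrt_nth_less[OF xs(3), of b a] that
        no_loops[of "(xs ! a, xs ! b)"]
      by (cases a b rule: linorder_cases) auto
    have arcs: "parcs (letter_graph P (map l xs)) = F ` parcs G"
    proof (intro set_eqI iffI)
      fix e assume "e \<in> parcs (letter_graph P (map l xs))"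
      then obtain i j where ij: "e = (i, j)" "i \<in> {1..length xs}" "j \<in> {1..length xs}"
        "i < j \<and> (map l xs ! (i - 1), map l xs ! (j - 1)) \<in> P \<or>
         j < i \<and> (map l xs ! (j - 1), map l xs ! (i - 1)) \<in> P"
        by (auto simp: letter_graph_def)
      then obtain a b where ab: "i = Suc a" "j = Suc b" "a < length xs" "b < length xs"
        by (metis atLeastAtMost_iff One_nat_def Suc_le_D Suc_le_lessD)
      then have "(xs ! a, xs ! b) \<in> parcs G" using edge ij by auto
      moreover have "e = F (xs ! a, xs ! b)" using ab ij f_nth by (simp add: F_def)
      ultimately show "e \<in> F ` parcs G" by blast
    next
      fix e assume "e \<in> F ` parcs G"
      then obtain u v where uv: "(u, v) \<in> parcs G" "e = (f u, f v)" by (auto simp: F_def)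
      then obtain a b where ab: "u = xs ! a" "v = xs ! b" "a < length xs" "b < length xs"
        using V_cases in_arcsD1 in_arcsD2 by (metis)
      then show "e \<in> parcs (letter_graph P (map l xs))"
        using uv edge[of a b] f_nth by (auto simp: letter_graph_def)
    qed
    let ?h = "\<lparr>iso_verts = f, iso_arcs = F, iso_head = snd, iso_tail = fst\<rparr>"
    have "inj_on F (parcs G)"
    proof (rule inj_onI)
      fix e e' assume e: "e \<in> parcs G" "e' \<in> parcs G" "F e = F e'"
      obtain u v u' v' where uv: "e = (u, v)" "e' = (u', v')" by (cases e, cases e')
      then have "f u = f u'" "f v = f v'" using e by (auto simp: F_def)
      then show "e = e'" using inj_onD[OF inj] in_arcsD1 in_arcsD2 e uv by blast
    qed
    then have "pre_digraph.digraph_isomorphism (with_proj G) ?h"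
      using inj wf_digraph by (auto simp: pre_digraph.digraph_isomorphism_def F_def)
    moreover have "with_proj (letter_graph P (map l xs)) = app_iso ?h (with_proj G)"
      using arcs verts by (simp add: app_iso_def with_proj_def letter_graph_def)
    ultimately show "\<exists>w. digraph_iso (with_proj G) (with_proj (letter_graph P w))"
      unfolding digraph_iso_def by blast
  qed
qed

section \<open>A Turing machine that inspects all tuples of vertices\<close>

text \<open>The \<open>Init\<close> states copy the length of the first row to both rulers,
  \<open>Check\<close> and \<open>Next_Row\<close> scan the matrix, and the \<open>Rewind\<close>
  states bring heads 0 and 2 back. The remaining working states increment the tuple, their parameter
  being the current digit: \<open>Find\<close> removes its mark, \<open>Put\<close> writes it one
  cell further, and \<open>Carry\<close> and \<open>Add\<close> reset an overflowing digit to
  0.\<close>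

datatype control =
    Init0 | Init | Init_Back
  | Check "(nat \<times> nat) set" | Next_Row "(nat \<times> nat) set" | Rewind0 | Rewind2
  | Find nat | Put nat | Carry nat | Add nat | Return
  | Acc | Rej

text \<open>
  The machine runs through all tuples \<open>i\<close> with \<open>i p < n\<close> for \<open>p < k\<close> in the manner of an
  odometer. Tape 0 holds the adjacency matrix; tapes 1 and 2 are identical rulers of length \<open>n\<close>
  whose cell \<open>x\<close> stores the set of all \<open>p\<close> with \<open>i p = x\<close>. While tape 0 is scanned, head 1 follows
  the column and head 2 the row, so that \<open>Check S\<close> collects in \<open>S\<close> the adjacent pairs of the tuple.
\<close>

definition mark_code :: "nat set \<Rightarrow> nat" where
  "mark_code X = Suc (set_encode X)"

locale tuple_machine =
  fixes k :: nat and T :: "(nat \<times> nat) set \<Rightarrow> bool"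
  assumes k_pos: "0 < k"
begin

text \<open>Inverse of \<open>mark_code\<close>, whose \<open>Suc\<close> keeps even an unmarked
  ruler cell distinct from the blank. Intersecting with \<open>{..<k}\<close> makes every symbol
  decode to a legal set of marks, so \<open>controls\<close> is closed under
  \<open>action\<close>.\<close>

definition cell :: "nat \<Rightarrow> nat set" where
  "cell s = set_decode (s - 1) \<inter> {..<k}"

fun action :: "control \<Rightarrow> nat \<Rightarrow> nat \<Rightarrow> nat \<Rightarrow> control \<times> (nat \<times> move) list" where
  "action Init0 a b c =
     (if a = 0 then (Acc, [(a, Move_None), (b, Move_None), (c, Move_None)])
      else (Init, [(a, Move_Right), (mark_code {..<k}, Move_Right), (mark_code {..<k}, Move_Right)]))"
| "action Init a b c =
     (if a = 3 then (Init_Back, [(a, Move_Left), (b, Move_Left), (c, Move_Left)])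
      else (Init, [(a, Move_Right), (mark_code {}, Move_Right), (mark_code {}, Move_Right)]))"
| "action Init_Back a b c =
     (if b = 0 then (Check {}, [(a, Move_Right), (b, Move_Right), (c, Move_Right)])
      else (Init_Back, [(a, Move_Left), (b, Move_Left), (c, Move_Left)]))"
| "action (Check S) a b c =
     (if a = 0 then
        if T S then (Rewind0, [(a, Move_Left), (b, Move_None), (c, Move_Left)])
        else (Rej, [(a, Move_None), (b, Move_None), (c, Move_None)])
      else if a = 3 then (Next_Row S, [(a, Move_Right), (b, Move_Left), (c, Move_Right)])
      else (Check (if a = 2 then S \<union> cell c \<times> cell b else S),
             [(a, Move_Right), (b, Move_Right), (c, Move_None)]))"
| "action (Next_Row S) a b c =
     (if b = 0 then (Check S, [(a, Move_None), (b, Move_Right), (c, Move_None)])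
      else (Next_Row S, [(a, Move_None), (b, Move_Left), (c, Move_None)]))"
| "action Rewind0 a b c =
     (if a = 0 then (Rewind2, [(a, Move_Right), (b, Move_None), (c, Move_None)])
      else (Rewind0, [(a, Move_Left), (b, Move_None), (c, Move_None)]))"
| "action Rewind2 a b c =
     (if c = 0 then (Find 0, [(a, Move_None), (b, Move_None), (c, Move_Right)])
      else (Rewind2, [(a, Move_None), (b, Move_None), (c, Move_Left)]))"
| "action (Find p) a b c =
     (if p \<in> cell b then (Put p, [(a, Move_None), (mark_code (cell b - {p}), Move_Right),
        (mark_code (cell b - {p}), Move_Right)])
      else (Find p, [(a, Move_None), (b, Move_Right), (c, Move_Right)]))"
| "action (Put p) a b c =
     (if b = 0 then (Carry p, [(a, Move_None), (b, Move_Left), (c, Move_Left)])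
      else (Return, [(a, Move_None), (mark_code (insert p (cell b)), Move_Left),
        (mark_code (insert p (cell b)), Move_Left)]))"
| "action (Carry p) a b c =
     (if b = 0 then (Add p, [(a, Move_None), (b, Move_Right), (c, Move_Right)])
      else (Carry p, [(a, Move_None), (b, Move_Left), (c, Move_Left)]))"
| "action (Add p) a b c =
     (if Suc p < k then Find (Suc p) else Acc,
      [(a, Move_None), (mark_code (insert p (cell b)), Move_None),
        (mark_code (insert p (cell b)), Move_None)])"
| "action Return a b c =
     (if b = 0 then (Check {}, [(a, Move_None), (b, Move_Right), (c, Move_Right)])
      else (Return, [(a, Move_None), (b, Move_Left), (c, Move_Left)]))"
| "action Acc a b c = (Acc, [(a, Move_None), (b, Move_None), (c, Move_None)])"
| "action Rej a b c = (Rej, [(a, Move_None), (b, Move_None), (c, Move_None)])"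

text \<open>The type \<open>control\<close> is infinite; this finite part, whose size depends on k
  alone, contains the start state and is closed under \<open>action\<close>.\<close>

definition controls :: "control set" where
  "controls = {Init0, Init, Init_Back, Rewind0, Rewind2, Return, Acc, Rej}
     \<union> Check ` Pow ({..<k} \<times> {..<k}) \<union> Next_Row ` Pow ({..<k} \<times> {..<k})
     \<union> Find ` {..<k} \<union> Put ` {..<k} \<union> Carry ` {..<k} \<union> Add ` {..<k}"

lemma finite_controls: "finite controls"
  by (simp add: controls_def)

lemma cell_subset: "cell s \<subseteq> {..<k}"
  by (simp add: cell_def)

lemma action_in_controls: "s \<in> controls \<Longrightarrow> fst (action s a b c) \<in> controls"
  using k_pos cell_subset[of b] cell_subset[of c]
  by (cases s) (auto simp: controls_def image_iff)

lemma length_action: "length (snd (action s a b c)) = 3"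
  by (cases s) auto

lemma mark_code_less: "X \<subseteq> {..<k} \<Longrightarrow> mark_code X < 2 ^ k + 4"
proof -
  assume "X \<subseteq> {..<k}"
  then have "set_encode X \<le> set_encode {..<k}"
    by (simp add: set_encode_def sum_mono2)
  also have "set_encode {..<k} < 2 ^ k"
    using mask_eq_sum_exp_nat[of k, symmetric] by (simp add: set_encode_def lessThan_def)
  finally show ?thesis by (simp add: mark_code_def)
qed

lemma action_symbols:
  assumes "s \<in> controls" "a < N" "b < N" "c < N" and code: "\<And>X. X \<subseteq> {..<k} \<Longrightarrow> mark_code X < N"
  shows "fst ` set (snd (action s a b c)) \<subseteq> {..<N}"
proof -
  have marks: "mark_code {..<k} < N" "mark_code {} < N" "mark_code (cell x - {p}) < N" for x p
    using cell_subset[of x] by (auto intro!: code)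
  have insert: "mark_code (insert p (cell x)) < N" if "p < k" for x p
    using cell_subset[of x] that by (auto intro!: code)
  show ?thesis
    using assms(1-4) by (cases s) (auto simp: controls_def marks insert)
qed

section \<open>Symbolic states and their numbering\<close>

fun sstep :: "control \<times> tape list \<Rightarrow> control \<times> tape list" where
  "sstep (s, ts) =
     (if s = Acc \<or> s = Rej then (s, ts)
      else case action s (case ts ! 0 of (f, h) \<Rightarrow> f h) (case ts ! 1 of (f, h) \<Rightarrow> f h)
        (case ts ! 2 of (f, h) \<Rightarrow> f h) of (s', as) \<Rightarrow> (s', map2 tape_act as ts))"

definition num :: "control \<Rightarrow> nat" where
  "num = (SOME e. bij_betw e controls {..<card controls})"

lemma bij_num: "bij_betw num controls {..<card controls}"
  unfolding num_def
  by (rule someI_ex[of "\<lambda>e. bij_betw e controls {..<card controls}"])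
    (use ex_bij_betw_finite_nat[OF finite_controls] in \<open>simp add: lessThan_atLeast0\<close>)

text \<open>The bound \<open>2 ^ k + 4\<close> on symbols exceeds the mark codes, which are at most
  2^k, and the input symbols 1, 2, 3.\<close>

definition machine :: tm where
  "machine = \<lparr>tapes = 3, symbols = 2 ^ k + 4, states = card controls,
     start = num Init0, accept = num Acc, reject = num Rej,
     delta = (\<lambda>q ss. case action (inv_into controls num q) (ss ! 0) (ss ! 1) (ss ! 2) of
       (s', as) \<Rightarrow> (num s', as))\<rparr>"

lemma num_less: "s \<in> controls \<Longrightarrow> num s < card controls"
  using bij_num by (auto simp: bij_betw_def)

lemma num_eq_iff: "s \<in> controls \<Longrightarrow> s' \<in> controls \<Longrightarrow> num s = num s' \<longleftrightarrow> s = s'"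
  using bij_num by (auto simp: bij_betw_def dest: inj_onD)

lemma inv_num: "s \<in> controls \<Longrightarrow> inv_into controls num (num s) = s"
  using bij_num by (simp add: bij_betw_def)

lemma start_and_halting_in_controls: "Init0 \<in> controls" "Acc \<in> controls" "Rej \<in> controls"
  by (auto simp: controls_def)

lemma wf_machine: "wf_tm machine"
proof -
  have "case delta machine q ss of (q', as) \<Rightarrow>
      q' < card controls \<and> length as = 3 \<and> fst ` set as \<subseteq> {..<2 ^ k + 4}"
    if q: "q < card controls" and ss: "length ss = 3" "set ss \<subseteq> {..<2 ^ k + 4}" for q ss
  proof -
    let ?s = "inv_into controls num q"
    have s: "?s \<in> controls"
      using q bij_num by (metis bij_betw_def inv_into_into lessThan_iff)
    have mem: "ss ! 0 < 2 ^ k + 4" "ss ! 1 < 2 ^ k + 4" "ss ! 2 < 2 ^ k + 4"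
      using ss nth_mem[of 0 ss] nth_mem[of 1 ss] nth_mem[of 2 ss] by (simp_all add: subset_iff)
    show ?thesis
      using action_in_controls[OF s, of "ss ! 0" "ss ! 1" "ss ! 2"] action_symbols[OF s mem mark_code_less]
        length_action[of ?s "ss ! 0" "ss ! 1" "ss ! 2"] num_less
      by (simp add: machine_def case_prod_beta)
  qed
  moreover have "num Acc \<noteq> num Rej"
    using num_eq_iff[OF start_and_halting_in_controls(2,3)] by simp
  ultimately show ?thesis
    unfolding wf_tm_def using start_and_halting_in_controls num_less by (simp add: machine_def)
qed

text \<open>Invariance of \<open>controls\<close> is what lets \<open>inv_into\<close> undo
  \<open>num\<close> at every step, so that runs can be analysed with \<open>sstep\<close>.\<close>

lemma tm_step_machine:
  assumes "s \<in> controls" "length ts = 3"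
  shows "tm_step machine (num s, ts) = (num (fst (sstep (s, ts))), snd (sstep (s, ts)))"
    "fst (sstep (s, ts)) \<in> controls" "length (snd (sstep (s, ts))) = 3"
proof -
  let ?f = "\<lambda>j. case ts ! j of (f, h) \<Rightarrow> f h"
  obtain s' as where tr: "action s (?f 0) (?f 1) (?f 2) = (s', as)" by fastforce
  have eqs: "num s = num Acc \<longleftrightarrow> s = Acc" "num s = num Rej \<longleftrightarrow> s = Rej"
    using num_eq_iff assms start_and_halting_in_controls by auto
  have as: "s' \<in> controls" "length as = 3"
    using action_in_controls[OF assms(1), of "?f 0" "?f 1" "?f 2"]
      length_action[of s "?f 0" "?f 1" "?f 2"] tr by auto
  show "tm_step machine (num s, ts) = (num (fst (sstep (s, ts))), snd (sstep (s, ts)))"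
    using assms eqs tr by (simp add: machine_def inv_num)
  show "fst (sstep (s, ts)) \<in> controls" "length (snd (sstep (s, ts))) = 3"
    using assms tr as by auto
qed

lemma funpow_machine:
  assumes "s \<in> controls" "length ts = 3"
  shows "(tm_step machine ^^ t) (num s, ts) =
      (num (fst ((sstep ^^ t) (s, ts))), snd ((sstep ^^ t) (s, ts))) \<and>
    fst ((sstep ^^ t) (s, ts)) \<in> controls \<and> length (snd ((sstep ^^ t) (s, ts))) = 3"
proof (induction t)
  case 0
  then show ?case using assms by simp
next
  case (Suc t)
  obtain s' ts' where eq: "(sstep ^^ t) (s, ts) = (s', ts')" by fastforce
  with Suc have "s' \<in> controls" "length ts' = 3" by auto
  from tm_step_machine[OF this] Suc eq show ?case
    by (simp del: sstep.simps tm_step.simps)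
qed

section \<open>Reachability within a time bound\<close>

text \<open>Upper bounds add up under composition and can be weakened; \<open>reach_halt\<close>
  recovers an exact number of steps, since halting configurations are fixed points.\<close>

definition reach :: "nat \<Rightarrow> control \<times> tape list \<Rightarrow> control \<times> tape list \<Rightarrow> bool" where
  "reach b c c' \<longleftrightarrow> (\<exists>t\<le>b. (sstep ^^ t) c = c')"

lemma reach_step: "sstep c = c' \<Longrightarrow> reach 1 c c'"
  unfolding reach_def by (intro exI[of _ 1]) simp

lemma reach_trans: "reach b c c' \<Longrightarrow> reach b' c' c'' \<Longrightarrow> reach (b + b') c c''"
proof -
  assume "reach b c c'" "reach b' c' c''"
  then obtain t t' where "t \<le> b" "(sstep ^^ t) c = c'" "t' \<le> b'" "(sstep ^^ t') c' = c''"
    by (auto simp: reach_def)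
  then have "t' + t \<le> b + b'" "(sstep ^^ (t' + t)) c = c''"
    by (simp_all add: funpow_add)
  then show ?thesis unfolding reach_def by blast
qed

lemma reach_mono: "reach b c c' \<Longrightarrow> b \<le> b' \<Longrightarrow> reach b' c c'"
  unfolding reach_def using order_trans by blast

lemma reach_refl: "reach b c c"
  unfolding reach_def by (intro exI[of _ 0]) simp

lemma reach_up:
  assumes "\<And>j. j < m \<Longrightarrow> sstep (C j) = C (Suc j)"
  shows "reach m (C 0) (C m)"
  using assms
proof (induction m)
  case (Suc m)
  then have "reach (m + 1) (C 0) (C (Suc m))"
    by (intro reach_trans[where c' = "C m"] reach_step) auto
  then show ?case by simp
qed (simp add: reach_refl)

text \<open>Made for leftward sweeps with a head at \<open>int j - 1\<close> in \<open>C j\<close>: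
  in \<open>C 0\<close> it reads the blank at -1, where the step to \<open>D\<close> turns
  around.\<close>

lemma reach_down:
  assumes "\<And>j. j < m \<Longrightarrow> sstep (C (Suc j)) = C j" "sstep (C 0) = D"
  shows "reach (Suc m) (C m) D"
  using assms
proof (induction m)
  case 0
  then show ?case using reach_step[of "C 0" D] by simp
next
  case (Suc m)
  then have "reach (1 + Suc m) (C (Suc m)) D"
    by (intro reach_trans[where c' = "C m"] reach_step) auto
  then show ?case by simp
qed

lemma reach_halt:
  assumes "reach b c c'" "fst c' = Acc \<or> fst c' = Rej" "b \<le> t"
  shows "(sstep ^^ t) c = c'"
proof -
  obtain u where u: "u \<le> b" "(sstep ^^ u) c = c'" using assms(1) by (auto simp: reach_def)
  have "sstep c' = c'" using assms(2) by (cases c') auto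
  then have "(sstep ^^ d) c' = c'" for d by (induction d) auto
  then have "(sstep ^^ (t - u)) ((sstep ^^ u) c) = c'" using u by simp
  moreover have "t = (t - u) + u" using u(1) assms(3) by simp
  ultimately show ?thesis by (metis funpow_add comp_apply)
qed

end

section \<open>The input word and its entries\<close>

definition matrix_word :: "nat \<Rightarrow> (nat \<Rightarrow> nat \<Rightarrow> bool) \<Rightarrow> nat list" where
  "matrix_word n A = concat (map (\<lambda>r. map (\<lambda>c. if A r c then 2 else 1) [0..<n] @ [3]) [0..<n])"

lemma concat_equal_lengths:
  assumes "\<And>r. r < m \<Longrightarrow> length (g r) = d"
  shows "concat (map g [0..<m]) = map (\<lambda>x. g (x div d) ! (x mod d)) [0..<m * d]"
  using assms
proof (induction m)
  case (Suc m)
  show ?case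
  proof (cases "d = 0")
    case True
    then show ?thesis using Suc.prems by auto
  next
    case False
    have "[0..<Suc m * d] = [0..<m * d] @ map (\<lambda>x. x + m * d) [0..<d]"
      using upt_add_eq_append[of 0 "m * d" d] by (simp add: map_add_upt add.commute)
    moreover have "map (\<lambda>x. g (x div d) ! (x mod d)) (map (\<lambda>x. x + m * d) [0..<d]) = g m"
      using Suc.prems[of m] False by (intro nth_equalityI) auto
    ultimately show ?thesis using Suc by simp
  qed
qed simp

lemma matrix_word_eq:
  "matrix_word n A = map (\<lambda>x. if x mod Suc n = n then 3 else if A (x div Suc n) (x mod Suc n) then 2 else 1)
     [0..<n * Suc n]"
proof -
  have "matrix_word n A = map (\<lambda>x. (map (\<lambda>c. if A (x div Suc n) c then 2 else 1) [0..<n] @ [3]) ! (x mod Suc n))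
     [0..<n * Suc n]"
    unfolding matrix_word_def by (rule concat_equal_lengths) simp
  also have "\<dots> = map (\<lambda>x. if x mod Suc n = n then 3 else if A (x div Suc n) (x mod Suc n) then 2 else 1)
     [0..<n * Suc n]"
  proof (rule map_cong)
    fix x
    have "x mod Suc n = n \<or> x mod Suc n < n"
      using mod_less_divisor[of "Suc n" x] by linarith
    then show "(map (\<lambda>c. if A (x div Suc n) c then 2 else 1) [0..<n] @ [3]) ! (x mod Suc n) =
        (if x mod Suc n = n then 3 else if A (x div Suc n) (x mod Suc n) then 2 else (1 :: nat))"
      by (auto simp: nth_append)
  qed simp
  finally show ?thesis .
qed

section \<open>Tuples as numerals\<close>

text \<open>The number with base-n digits \<open>i p\<close>, least significant first. It orders the
  tuples as the odometer visits them and so measures progress.\<close>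

definition tuple_value :: "nat \<Rightarrow> nat \<Rightarrow> (nat \<Rightarrow> nat) \<Rightarrow> nat" where
  "tuple_value n k i = (\<Sum>p<k. i p * n ^ p)"

lemma tuple_value_Suc: "tuple_value n (Suc k) i = i 0 + n * tuple_value n k (\<lambda>p. i (Suc p))"
  by (simp add: tuple_value_def sum.lessThan_Suc_shift sum_distrib_left algebra_simps del: sum.lessThan_Suc)

lemma tuple_value_less: "(\<forall>p<k. i p < n) \<Longrightarrow> tuple_value n k i < n ^ k"
proof (induction k arbitrary: i)
  case 0
  then show ?case by (simp add: tuple_value_def)
next
  case (Suc k)
  have "tuple_value n k (\<lambda>p. i (Suc p)) + 1 \<le> n ^ k"
    using Suc.IH[of "\<lambda>p. i (Suc p)"] Suc.prems by simp
  then have "n * (tuple_value n k (\<lambda>p. i (Suc p)) + 1) \<le> n * n ^ k" by (rule mult_le_mono2)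
  moreover have "i 0 < n" using Suc.prems by simp
  ultimately show ?case by (simp add: tuple_value_Suc)
qed

lemma tuple_value_inj:
  assumes "tuple_value n k i = tuple_value n k j" "\<forall>p<k. i p < n" "\<forall>p<k. j p < n"
  shows "\<forall>p<k. i p = j p"
  using assms
proof (induction k arbitrary: i j)
  case (Suc k)
  let ?i = "\<lambda>p. i (Suc p)" and ?j = "\<lambda>p. j (Suc p)"
  have eq: "i 0 + n * tuple_value n k ?i = j 0 + n * tuple_value n k ?j"
    using Suc.prems(1) by (simp add: tuple_value_Suc)
  have less: "i 0 < n" "j 0 < n" using Suc.prems by auto
  have zero: "i 0 = j 0" using arg_cong[OF eq, of "\<lambda>x. x mod n"] less by simp
  then have "tuple_value n k ?i = tuple_value n k ?j" using eq less by simp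
  then have "\<forall>p<k. ?i p = ?j p" by (rule Suc.IH) (use Suc.prems in auto)
  then show ?case using zero by (auto simp: less_Suc_eq_0_disj)
qed simp

text \<open>Both sides carry an extra summand so that natural subtraction is avoided.\<close>

lemma tuple_value_update:
  "p < k \<Longrightarrow> tuple_value n k (i(p := x)) + i p * n ^ p = tuple_value n k i + x * n ^ p"
  by (simp add: tuple_value_def sum.remove[of "{..<k}" p])

section \<open>Configurations of a run\<close>

locale tuple_run = tuple_machine +
  fixes n :: nat and A :: "nat \<Rightarrow> nat \<Rightarrow> bool"
begin

definition W :: "int \<Rightarrow> nat" where
  "W = fst (input_tape (matrix_word n A))"

text \<open>The length is a parameter because rulers grow during initialisation. The blanks on both
  sides are the turning points of the heads.\<close>

definition ruler :: "nat \<Rightarrow> (nat \<Rightarrow> nat set) \<Rightarrow> int \<Rightarrow> nat" where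
  "ruler m X x = (if 0 \<le> x \<and> x < int m then mark_code (X (nat x)) else 0)"

definition marks :: "(nat \<Rightarrow> nat) \<Rightarrow> nat \<Rightarrow> nat set" where
  "marks i x = {p. p < k \<and> i p = x}"

definition cfg :: "control \<Rightarrow> int \<Rightarrow> nat \<Rightarrow> (nat \<Rightarrow> nat set) \<Rightarrow> int \<Rightarrow> int \<Rightarrow> control \<times> tape list" where
  "cfg s h0 m X h1 h2 = (s, [(W, h0), (ruler m X, h1), (ruler m X, h2)])"

text \<open>The set held by \<open>Check\<close> when row r is about to be read.\<close>

definition seen :: "(nat \<Rightarrow> nat) \<Rightarrow> nat \<Rightarrow> (nat \<times> nat) set" where
  "seen i r = {(p, q). p < k \<and> q < k \<and> i p < r \<and> A (i p) (i q)}"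

lemma W_nth: "x < n * Suc n \<Longrightarrow> W (int x) =
    (if x mod Suc n = n then 3 else if A (x div Suc n) (x mod Suc n) then 2 else 1)"
  by (simp add: W_def input_tape_def matrix_word_eq del: mult_Suc_right of_nat_mult)

lemma W_blank: "W (-1) = 0" "W (int (n * Suc n)) = 0"
  by (simp_all add: W_def input_tape_def matrix_word_eq del: mult_Suc_right)

lemma W_nonblank: "x < n * Suc n \<Longrightarrow> 0 < W (int x)"
  by (simp add: W_nth del: mult_Suc_right)

lemma index_bound:
  assumes "r < n" "c \<le> n" shows "r * Suc n + c < n * Suc n"
proof -
  have "r * Suc n + c < Suc r * Suc n" using assms(2) by simp
  also have "\<dots> \<le> n * Suc n" using assms(1) by (intro mult_le_mono1) simp
  finally show ?thesis .
qed

lemma W_entry: "r < n \<Longrightarrow> c < n \<Longrightarrow> W (int (r * Suc n + c)) = (if A r c then 2 else 1)"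
proof -
  assume rc: "r < n" "c < n"
  have "(r * Suc n + c) mod Suc n = c"
    using rc by (metis less_Suc_eq mod_less mod_mult_self3)
  moreover have "(r * Suc n + c) div Suc n = r"
    using rc by (metis add.right_neutral div_less div_mult_self3 less_Suc_eq nat.distinct(1))
  ultimately show ?thesis
    using W_nth[OF index_bound, of r c] rc by simp
qed

lemma W_row_end: "r < n \<Longrightarrow> W (int (r * Suc n + n)) = 3"
proof -
  assume r: "r < n"
  have "(r * Suc n + n) mod Suc n = n"
    by (metis lessI mod_less mod_mult_self3)
  then show ?thesis using W_nth[OF index_bound, of r n] r by simp
qed

lemma mark_code_pos: "0 < mark_code X" "mark_code X \<noteq> 0"
  by (simp_all add: mark_code_def)

lemma cell_mark_code: "X \<subseteq> {..<k} \<Longrightarrow> cell (mark_code X) = X"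
  using finite_subset[of X "{..<k}"] by (auto simp: cell_def mark_code_def)

lemma marks_subset: "marks i x \<subseteq> {..<k}"
  by (auto simp: marks_def)

lemma ruler_simps [simp]:
  "x < m \<Longrightarrow> ruler m X (int x) = mark_code (X x)"
  "0 < m \<Longrightarrow> ruler m X 0 = mark_code (X 0)"
  "ruler m X (int m) = 0" "ruler m X (-1) = 0"
  "ruler 0 X = (\<lambda>_. 0)"
  by (auto simp: ruler_def)

lemma ruler_write: "x < m \<Longrightarrow> (ruler m X)(int x := mark_code Y) = ruler m (X(x := Y))"
  by (auto simp: ruler_def fun_eq_iff)

lemma ruler_extend: "(ruler m X)(int m := mark_code (X m)) = ruler (Suc m) X"
  by (auto simp: ruler_def fun_eq_iff)

section \<open>Initialisation and scan of the matrix\<close>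

lemma sstep_Init:
  assumes "W (int m) = 1 \<or> W (int m) = 2" "X m = {}"
  shows "sstep (cfg Init (int m) m X (int m) (int m)) =
    cfg Init (int (Suc m)) (Suc m) X (int (Suc m)) (int (Suc m))"
proof -
  have "(ruler m X)(int m := mark_code {}) = ruler (Suc m) X"
    using ruler_extend[of m X] assms(2) by simp
  then show ?thesis using assms(1) by (auto simp: cfg_def)
qed

text \<open>All marks start in cell 0, which is the zero tuple. The steps are 1 for the first cell,
  n - 1 for the others, 1 at the row end and n + 1 for the way back.\<close>

lemma reach_initialised:
  assumes "0 < n"
  shows "reach (2 * n + 2) (Init0, [(W, 0), (\<lambda>_. 0, 0), (\<lambda>_. 0, 0)])
    (cfg (Check {}) 0 n (marks (\<lambda>_. 0)) 0 0)"
proof -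
  let ?X = "marks (\<lambda>_. 0)"
  have X: "?X 0 = {..<k}" "?X (Suc m) = {}" for m by (auto simp: marks_def)
  have W0: "W 0 = 1 \<or> W 0 = 2" using W_entry[of 0 0] assms by auto
  have row: "W (int m) = 1 \<or> W (int m) = 2" if "m < n" for m
    using W_entry[of 0 m] assms that by auto
  have ext: "(\<lambda>_. 0)(0 := mark_code {..<k}) = ruler (Suc 0) ?X"
    using ruler_extend[of 0 ?X] X by simp
  have "reach 1 (Init0, [(W, 0), (\<lambda>_. 0, 0), (\<lambda>_. 0, 0)]) (cfg Init 1 1 ?X 1 1)"
    by (rule reach_step) (use W0 ext in \<open>auto simp: cfg_def\<close>)
  moreover have "reach (n - 1) (cfg Init 1 1 ?X 1 1) (cfg Init (int n) n ?X (int n) (int n))"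
  proof -
    let ?C = "\<lambda>j. cfg Init (int (Suc j)) (Suc j) ?X (int (Suc j)) (int (Suc j))"
    have "reach (n - 1) (?C 0) (?C (n - 1))"
    proof (rule reach_up, rule sstep_Init)
      fix j assume "j < n - 1"
      then have "Suc j < n" by simp
      then show "W (int (Suc j)) = 1 \<or> W (int (Suc j)) = 2" by (rule row)
    qed (rule X)
    then show ?thesis using assms by simp
  qed
  moreover have "reach 1 (cfg Init (int n) n ?X (int n) (int n))
      (cfg Init_Back (int n - 1) n ?X (int n - 1) (int n - 1))"
  proof (rule reach_step)
    have "W (int n) = 3" using W_row_end[of 0] assms by simp
    then show "sstep (cfg Init (int n) n ?X (int n) (int n)) =
        cfg Init_Back (int n - 1) n ?X (int n - 1) (int n - 1)"
      by (auto simp: cfg_def fun_upd_idem)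
  qed
  moreover have "reach (Suc n) (cfg Init_Back (int n - 1) n ?X (int n - 1) (int n - 1))
      (cfg (Check {}) 0 n ?X 0 0)"
    by (rule reach_down[where C = "\<lambda>j. cfg Init_Back (int j - 1) n ?X (int j - 1) (int j - 1)"])
      (auto simp: cfg_def mark_code_pos fun_upd_idem)
  ultimately have "reach (1 + (n - 1) + 1 + Suc n) (Init0, [(W, 0), (\<lambda>_. 0, 0), (\<lambda>_. 0, 0)])
    (cfg (Check {}) 0 n ?X 0 0)" by (blast intro: reach_trans)
  then show ?thesis by (rule reach_mono) (use assms in simp)
qed

lemma sstep_Check_entry:
  assumes "r < n" "c < n" "W h = (if A r c then 2 else 1)"
  shows "sstep (cfg (Check S) h n (marks i) (int c) (int r)) =
    cfg (Check (if A r c then S \<union> marks i r \<times> marks i c else S)) (h + 1) n (marks i) (int (Suc c)) (int r)"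
  using assms cell_mark_code[OF marks_subset] by (auto simp: cfg_def fun_upd_idem)

text \<open>At an adjacent entry, the product of the two mark sets consists of the pairs whose tuple
  entries are this row and this column. Reading takes n steps, the row end 1, and the return of head
  1 takes n + 1.\<close>

lemma reach_next_row:
  assumes r: "r < n" and i: "\<forall>p<k. i p < n"
  shows "reach (2 * n + 2) (cfg (Check (seen i r)) (int (r * Suc n)) n (marks i) 0 (int r))
    (cfg (Check (seen i (Suc r))) (int (Suc r * Suc n)) n (marks i) 0 (int (Suc r)))"
proof -
  \<comment> \<open>The pairs collected once j columns of row r have been read.\<close>
  let ?S = "\<lambda>j. seen i r \<union> {(p, q). p < k \<and> q < k \<and> i p = r \<and> i q < j \<and> A r (i q)}"
  let ?C = "\<lambda>j. cfg (Check (?S j)) (int (r * Suc n + j)) n (marks i) (int j) (int r)"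
  have S: "?S (Suc j) = (if A r j then ?S j \<union> marks i r \<times> marks i j else ?S j)" for j
    by (auto simp: marks_def less_Suc_eq)
  have "sstep (?C j) = ?C (Suc j)" if "j < n" for j
    using sstep_Check_entry[OF r that W_entry[OF r that], of "?S j" i] unfolding S
    by (simp add: algebra_simps)
  then have "reach n (?C 0) (?C n)" by (rule reach_up)
  moreover have "reach 1 (?C n)
      (cfg (Next_Row (?S n)) (int (Suc r * Suc n)) n (marks i) (int n - 1) (int (Suc r)))"
  proof (rule reach_step)
    have "sstep (cfg (Check (?S n)) h n (marks i) (int n) (int r)) =
      cfg (Next_Row (?S n)) (h + 1) n (marks i) (int n - 1) (int (Suc r))" if "W h = 3" for h
      using that r by (auto simp: cfg_def fun_upd_idem)
    from this[OF W_row_end[OF r]]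
    show "sstep (?C n) = cfg (Next_Row (?S n)) (int (Suc r * Suc n)) n (marks i) (int n - 1) (int (Suc r))"
      by (simp add: algebra_simps)
  qed
  moreover have "reach (Suc n)
      (cfg (Next_Row (?S n)) (int (Suc r * Suc n)) n (marks i) (int n - 1) (int (Suc r)))
      (cfg (Check (?S n)) (int (Suc r * Suc n)) n (marks i) 0 (int (Suc r)))"
    by (rule reach_down[where C = "\<lambda>j. cfg (Next_Row (?S n)) (int (Suc r * Suc n)) n (marks i) (int j - 1) (int (Suc r))"])
      (auto simp: cfg_def mark_code_pos fun_upd_idem)
  ultimately have "reach (n + 1 + Suc n) (?C 0)
    (cfg (Check (?S n)) (int (Suc r * Suc n)) n (marks i) 0 (int (Suc r)))"
    by (blast intro: reach_trans)
  moreover have "?S n = seen i (Suc r)"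
    using i by (auto simp: seen_def less_Suc_eq)
  moreover have "?S 0 = seen i r" by simp
  ultimately have "reach (n + 1 + Suc n) (cfg (Check (seen i r)) (int (r * Suc n)) n (marks i) 0 (int r))
    (cfg (Check (seen i (Suc r))) (int (Suc r * Suc n)) n (marks i) 0 (int (Suc r)))"
    by simp
  then show ?thesis by (rule reach_mono) simp
qed

lemma reach_checked:
  assumes "\<forall>p<k. i p < n"
  shows "reach (2 * n * Suc n) (cfg (Check {}) 0 n (marks i) 0 0)
    (cfg (Check (seen i n)) (int (n * Suc n)) n (marks i) 0 (int n))"
proof -
  have "reach (2 * r * Suc n) (cfg (Check {}) 0 n (marks i) 0 0)
    (cfg (Check (seen i r)) (int (r * Suc n)) n (marks i) 0 (int r))" if "r \<le> n" for r
    using that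
  proof (induction r)
    case 0
    have "seen i 0 = {}" by (simp add: seen_def)
    then show ?case by (simp add: reach_refl)
  next
    case (Suc r)
    then have "reach (2 * r * Suc n + (2 * n + 2)) (cfg (Check {}) 0 n (marks i) 0 0)
      (cfg (Check (seen i (Suc r))) (int (Suc r * Suc n)) n (marks i) 0 (int (Suc r)))"
      by (intro reach_trans[OF Suc.IH reach_next_row]) (use assms in auto)
    then show ?case by (rule reach_mono) simp
  qed
  then show ?thesis by blast
qed

lemma reach_rejected:
  assumes "\<forall>p<k. i p < n" "\<not> T (seen i n)"
  shows "\<exists>c. reach (2 * n * Suc n + 1) (cfg (Check {}) 0 n (marks i) 0 0) c \<and> fst c = Rej"
proof -
  have "sstep (cfg (Check (seen i n)) h n (marks i) 0 (int n)) = cfg Rej h n (marks i) 0 (int n)"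
    if "W h = 0" for h
    using that assms(2) by (auto simp: cfg_def fun_upd_idem)
  from reach_step[OF this[OF W_blank(2)]] show ?thesis
    using reach_trans[OF reach_checked[OF assms(1)]] by (fastforce simp: cfg_def)
qed

text \<open>After the scan head 1 is already at 0, while heads 0 and 2 stand just past their right
  ends. To the scan this adds 1 step and two sweeps of \<open>n * Suc n + 1\<close> and n + 1
  steps.\<close>

lemma reach_odometer:
  assumes "\<forall>p<k. i p < n" "T (seen i n)" "0 < n"
  shows "reach (3 * n * Suc n + n + 3) (cfg (Check {}) 0 n (marks i) 0 0)
    (cfg (Find 0) 0 n (marks i) 0 0)"
proof -
  let ?L = "n * Suc n"
  have "sstep (cfg (Check (seen i n)) h n (marks i) 0 (int n)) =
      cfg Rewind0 (h - 1) n (marks i) 0 (int n - 1)"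
    if "W h = 0" for h
    using that assms(2,3) by (auto simp: cfg_def fun_upd_idem)
  from reach_step[OF this[OF W_blank(2)]]
  have "reach 1 (cfg (Check (seen i n)) (int ?L) n (marks i) 0 (int n))
    (cfg Rewind0 (int ?L - 1) n (marks i) 0 (int n - 1))" .
  moreover have "reach (Suc ?L) (cfg Rewind0 (int ?L - 1) n (marks i) 0 (int n - 1))
      (cfg Rewind2 0 n (marks i) 0 (int n - 1))"
  proof (rule reach_down[where C = "\<lambda>j. cfg Rewind0 (int j - 1) n (marks i) 0 (int n - 1)"])
    fix j assume "j < ?L"
    then have "0 < W (int j)" by (rule W_nonblank)
    then show "sstep (cfg Rewind0 (int (Suc j) - 1) n (marks i) 0 (int n - 1)) =
        cfg Rewind0 (int j - 1) n (marks i) 0 (int n - 1)"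
      by (auto simp: cfg_def fun_upd_idem)
  qed (auto simp: cfg_def fun_upd_idem W_blank)
  moreover have "reach (Suc n) (cfg Rewind2 0 n (marks i) 0 (int n - 1))
      (cfg (Find 0) 0 n (marks i) 0 0)"
    by (rule reach_down[where C = "\<lambda>j. cfg Rewind2 0 n (marks i) 0 (int j - 1)"])
      (auto simp: cfg_def mark_code_pos fun_upd_idem)
  moreover have "reach (2 * n * Suc n) (cfg (Check {}) 0 n (marks i) 0 0)
      (cfg (Check (seen i n)) (int ?L) n (marks i) 0 (int n))"
    by (rule reach_checked) (rule assms(1))
  ultimately have "reach (2 * n * Suc n + 1 + Suc ?L + Suc n) (cfg (Check {}) 0 n (marks i) 0 0)
      (cfg (Find 0) 0 n (marks i) 0 0)"
    by (blast intro: reach_trans)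
  then show ?thesis by (rule reach_mono) simp
qed

section \<open>Incrementing the tuple\<close>

lemma sstep_Find_skip:
  assumes "p \<notin> marks i x" "x < n"
  shows "sstep (cfg (Find p) 0 n (marks i) (int x) (int x)) =
    cfg (Find p) 0 n (marks i) (int (Suc x)) (int (Suc x))"
  using assms cell_mark_code[OF marks_subset] by (auto simp: cfg_def fun_upd_idem)

text \<open>The mark p is on no cell until the next write, hence the explicit update of
  \<open>marks i\<close>.\<close>

lemma reach_Put:
  assumes "p < k" "i p < n"
  shows "reach (i p + 1) (cfg (Find p) 0 n (marks i) 0 0)
    (cfg (Put p) 0 n ((marks i)(i p := marks i (i p) - {p})) (int (Suc (i p))) (int (Suc (i p))))"
proof -
  let ?C = "\<lambda>j. cfg (Find p) 0 n (marks i) (int j) (int j)"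
  have "reach (i p) (?C 0) (?C (i p))"
    by (rule reach_up, rule sstep_Find_skip) (use assms in \<open>auto simp: marks_def\<close>)
  moreover have "p \<in> marks i (i p)" using assms by (simp add: marks_def)
  then have "sstep (?C (i p)) =
      cfg (Put p) 0 n ((marks i)(i p := marks i (i p) - {p})) (int (Suc (i p))) (int (Suc (i p)))"
    using assms cell_mark_code[OF marks_subset]
    by (auto simp: cfg_def fun_upd_idem ruler_write)
  then have "reach 1 (?C (i p))
      (cfg (Put p) 0 n ((marks i)(i p := marks i (i p) - {p})) (int (Suc (i p))) (int (Suc (i p))))"
    by (rule reach_step)
  ultimately show ?thesis using reach_trans by fastforce
qed

lemma reach_increment:
  assumes "p < k" "Suc (i p) < n"
  shows "reach (2 * n + 3) (cfg (Find p) 0 n (marks i) 0 0)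
    (cfg (Check {}) 0 n (marks (i(p := Suc (i p)))) 0 0)"
proof -
  let ?X = "(marks i)(i p := marks i (i p) - {p})" and ?Y = "marks (i(p := Suc (i p)))"
  have Y: "?X(Suc (i p) := insert p (marks i (Suc (i p)))) = ?Y"
    using assms(1) by (auto simp: marks_def fun_eq_iff)
  have "sstep (cfg (Put p) 0 n ?X (int (Suc (i p))) (int (Suc (i p)))) =
      cfg Return 0 n (?X(Suc (i p) := insert p (marks i (Suc (i p))))) (int (i p)) (int (i p))"
    using assms cell_mark_code[OF marks_subset] ruler_write[of "Suc (i p)" n ?X]
    by (auto simp: cfg_def fun_upd_idem mark_code_pos simp del: of_nat_Suc)
  then have "reach 1 (cfg (Put p) 0 n ?X (int (Suc (i p))) (int (Suc (i p))))
      (cfg Return 0 n ?Y (int (i p)) (int (i p)))"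
    unfolding Y by (rule reach_step)
  moreover have "reach (Suc (Suc (i p))) (cfg Return 0 n ?Y (int (Suc (i p)) - 1) (int (Suc (i p)) - 1))
      (cfg (Check {}) 0 n ?Y 0 0)"
    by (rule reach_down[where C = "\<lambda>j. cfg Return 0 n ?Y (int j - 1) (int j - 1)"])
      (use assms in \<open>auto simp: cfg_def mark_code_pos fun_upd_idem\<close>)
  then have "reach (Suc (Suc (i p))) (cfg Return 0 n ?Y (int (i p)) (int (i p))) (cfg (Check {}) 0 n ?Y 0 0)"
    by simp
  moreover have "reach (i p + 1) (cfg (Find p) 0 n (marks i) 0 0)
      (cfg (Put p) 0 n ?X (int (Suc (i p))) (int (Suc (i p))))"
    by (rule reach_Put) (use assms in auto)
  ultimately have "reach (i p + 1 + 1 + Suc (Suc (i p))) (cfg (Find p) 0 n (marks i) 0 0)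
      (cfg (Check {}) 0 n ?Y 0 0)"
    by (blast intro: reach_trans)
  \<comment> \<open>At most 2n steps are used; the weaker bound is that of
    \<open>reach_carry\<close>, so that one bound serves every digit.\<close>
  then show ?thesis by (rule reach_mono) (use assms in simp)
qed

text \<open>The digit is n - 1, so moving right leaves the ruler and \<open>Put\<close> reads a
  blank. When the last digit overflows, all tuples have been visited.\<close>

lemma reach_carry:
  assumes "p < k" "Suc (i p) = n"
  shows "reach (2 * n + 3) (cfg (Find p) 0 n (marks i) 0 0)
    (cfg (if Suc p < k then Find (Suc p) else Acc) 0 n (marks (i(p := 0))) 0 0)"
proof -
  let ?X = "(marks i)(i p := marks i (i p) - {p})" and ?Y = "marks (i(p := 0))"
  have n: "0 < n" using assms by simp
  have Y: "?X(0 := insert p (?X 0)) = ?Y"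
    using assms(1) by (auto simp: marks_def fun_eq_iff)
  have X: "?X x \<subseteq> {..<k}" for x using marks_subset by auto
  have "sstep (cfg (Put p) 0 n ?X (int n) (int n)) = cfg (Carry p) 0 n ?X (int n - 1) (int n - 1)"
    by (auto simp: cfg_def fun_upd_idem)
  then have "reach 1 (cfg (Put p) 0 n ?X (int n) (int n)) (cfg (Carry p) 0 n ?X (int n - 1) (int n - 1))"
    by (rule reach_step)
  moreover have "reach (Suc n) (cfg (Carry p) 0 n ?X (int n - 1) (int n - 1)) (cfg (Add p) 0 n ?X 0 0)"
    by (rule reach_down[where C = "\<lambda>j. cfg (Carry p) 0 n ?X (int j - 1) (int j - 1)"])
      (auto simp: cfg_def mark_code_pos fun_upd_idem)
  moreover have "sstep (cfg (Add p) 0 n ?X 0 0) =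
      cfg (if Suc p < k then Find (Suc p) else Acc) 0 n (?X(0 := insert p (?X 0))) 0 0"
    using ruler_write[OF n, of ?X "insert p (?X 0)"] cell_mark_code[OF X, of 0] n
    by (simp add: cfg_def fun_upd_idem del: fun_upd_apply)
  then have "reach 1 (cfg (Add p) 0 n ?X 0 0)
      (cfg (if Suc p < k then Find (Suc p) else Acc) 0 n ?Y 0 0)"
    unfolding Y by (rule reach_step)
  moreover have "reach n (cfg (Find p) 0 n (marks i) 0 0) (cfg (Put p) 0 n ?X (int n) (int n))"
    using reach_Put[of p i] assms by simp
  ultimately have "reach (n + 1 + Suc n + 1) (cfg (Find p) 0 n (marks i) 0 0)
      (cfg (if Suc p < k then Find (Suc p) else Acc) 0 n ?Y 0 0)"
    by (blast intro: reach_trans)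
  then show ?thesis by (rule reach_mono) simp
qed

abbreviation val :: "(nat \<Rightarrow> nat) \<Rightarrow> nat" where
  "val \<equiv> tuple_value n k"

text \<open>Generalised from adding 1 to adding n^p, so that a carry is the same task for the next
  digit.\<close>

lemma reach_next_tuple:
  assumes "\<forall>p<k. i p < n" "p < k"
  shows "\<exists>c. reach ((k - p) * (2 * n + 3)) (cfg (Find p) 0 n (marks i) 0 0) c \<and>
    (fst c = Acc \<and> n ^ k \<le> val i + n ^ p \<or>
     (\<exists>j. (\<forall>q<k. j q < n) \<and> val j = val i + n ^ p \<and> c = cfg (Check {}) 0 n (marks j) 0 0))"
  using assms
proof (induction "k - p" arbitrary: p i rule: less_induct)
  case less
  have kp: "k - p = Suc (k - Suc p)" using less.prems(2) by simp
  show ?case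
  proof (cases "Suc (i p) < n")
    case True
    let ?j = "i(p := Suc (i p))"
    have "reach ((k - p) * (2 * n + 3)) (cfg (Find p) 0 n (marks i) 0 0) (cfg (Check {}) 0 n (marks ?j) 0 0)"
      by (rule reach_mono[OF reach_increment[of p i]]) (use True less.prems(2) in \<open>simp_all add: kp\<close>)
    moreover have "val ?j = val i + n ^ p"
      using tuple_value_update[OF less.prems(2), of n i "Suc (i p)"] by simp
    moreover have "\<forall>q<k. ?j q < n" using True less.prems by simp
    ultimately show ?thesis by blast
  next
    case False
    then have last: "Suc (i p) = n" using less.prems by auto
    let ?j = "i(p := 0)"
    \<comment> \<open>Resetting a digit n - 1 loses (n - 1) n^p, so adding n^(p+1) afterwards
      reaches the original target.\<close>
    have val_j: "val ?j + n ^ Suc p = val i + n ^ p"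
      using tuple_value_update[OF less.prems(2), of n i 0] last by (metis add_0_right add.assoc mult_0 mult_Suc power_Suc add.commute)
    have step: "reach (2 * n + 3) (cfg (Find p) 0 n (marks i) 0 0)
        (cfg (if Suc p < k then Find (Suc p) else Acc) 0 n (marks ?j) 0 0)"
      using reach_carry less.prems(2) last by blast
    show ?thesis
    proof (cases "Suc p < k")
      case True
      have "k - Suc p < k - p" "\<forall>q<k. ?j q < n" using less.prems last by auto
      from less.hyps[OF this True] obtain c where c: "reach ((k - Suc p) * (2 * n + 3)) (cfg (Find (Suc p)) 0 n (marks ?j) 0 0) c"
        "fst c = Acc \<and> n ^ k \<le> val ?j + n ^ Suc p \<or>
         (\<exists>j. (\<forall>q<k. j q < n) \<and> val j = val ?j + n ^ Suc p \<and> c = cfg (Check {}) 0 n (marks j) 0 0)"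
        by blast
      have "reach ((k - p) * (2 * n + 3)) (cfg (Find p) 0 n (marks i) 0 0) c"
        using reach_trans[OF step, of _ c] c(1) True by (simp add: kp del: fun_upd_apply)
      then show ?thesis using c(2) unfolding val_j by blast
    next
      case False
      then have k: "k = Suc p" using less.prems(2) by simp
      have "n ^ k \<le> val i + n ^ p" using val_j unfolding k by (metis le_add2)
      moreover have "reach ((k - p) * (2 * n + 3)) (cfg (Find p) 0 n (marks i) 0 0)
        (cfg Acc 0 n (marks ?j) 0 0)"
        using step False k by simp
      ultimately show ?thesis by (intro exI conjI disjI1) (auto simp: cfg_def)
    qed
  qed
qed

section \<open>Verdict and running time\<close>

definition round_time :: nat where
  "round_time = 3 * n * Suc n + n + 3 + k * (2 * n + 3)"

text \<open>Induction on the number of tuples still to be visited, the current one included; each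
  costs at most one \<open>round_time\<close>.\<close>

lemma reach_verdict:
  assumes "0 < n" "\<forall>p<k. i p < n"
  shows "\<exists>c. reach ((n ^ k - val i) * round_time) (cfg (Check {}) 0 n (marks i) 0 0) c \<and>
    fst c = (if \<forall>j. (\<forall>p<k. j p < n) \<and> val i \<le> val j \<longrightarrow> T (seen j n) then Acc else Rej)"
  using assms(2)
proof (induction "n ^ k - val i" arbitrary: i rule: less_induct)
  case less
  have bound: "val i < n ^ k" using tuple_value_less[OF less.prems] by blast
  then have rounds: "n ^ k - val i = Suc (n ^ k - Suc (val i))" by simp
  show ?case
  proof (cases "T (seen i n)")
    case False
    then obtain c where c: "reach (2 * n * Suc n + 1) (cfg (Check {}) 0 n (marks i) 0 0) c" "fst c = Rej"
      using reach_rejected[OF less.prems] by blast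
    have "reach ((n ^ k - val i) * round_time) (cfg (Check {}) 0 n (marks i) 0 0) c"
      by (rule reach_mono[OF c(1)]) (simp add: rounds round_time_def)
    moreover have "\<not> (\<forall>j. (\<forall>p<k. j p < n) \<and> val i \<le> val j \<longrightarrow> T (seen j n))"
      using False less.prems by blast
    ultimately show ?thesis using c(2) by (intro exI[of _ c]) simp
  next
    case True
    obtain c where c: "reach (k * (2 * n + 3)) (cfg (Find 0) 0 n (marks i) 0 0) c"
      "fst c = Acc \<and> n ^ k \<le> val i + 1 \<or>
       (\<exists>j. (\<forall>q<k. j q < n) \<and> val j = val i + 1 \<and> c = cfg (Check {}) 0 n (marks j) 0 0)"
      using reach_next_tuple[OF less.prems k_pos] by auto
    have round: "reach round_time (cfg (Check {}) 0 n (marks i) 0 0) c"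
      unfolding round_time_def by (rule reach_trans[OF reach_odometer[OF less.prems True assms(1)] c(1)])
    \<comment> \<open>\<open>seen\<close> depends only on the entries below k, and
      \<open>tuple_value\<close> determines these.\<close>
    have same: "T (seen j n)" if "\<forall>p<k. j p < n" "val j = val i" for j
    proof -
      have "\<forall>p<k. j p = i p" using tuple_value_inj[OF that(2)] that(1) less.prems by blast
      then have "seen j n = seen i n" unfolding seen_def by auto
      then show ?thesis using True by simp
    qed
    from c(2) show ?thesis
    proof (elim disjE conjE exE)
      assume acc: "fst c = Acc" "n ^ k \<le> val i + 1"
      have "val j = val i" if "\<forall>p<k. j p < n" "val i \<le> val j" for j
        using tuple_value_less[of k j n] that acc(2) by auto
      then have "\<forall>j. (\<forall>p<k. j p < n) \<and> val i \<le> val j \<longrightarrow> T (seen j n)" using same by blast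
      moreover have "reach ((n ^ k - val i) * round_time) (cfg (Check {}) 0 n (marks i) 0 0) c"
        by (rule reach_mono[OF round]) (simp add: rounds)
      ultimately show ?thesis using acc(1) by (intro exI[of _ c]) simp
    next
      fix j assume j: "\<forall>q<k. j q < n" "val j = val i + 1" "c = cfg (Check {}) 0 n (marks j) 0 0"
      then obtain c' where c': "reach ((n ^ k - val j) * round_time) c c'"
        "fst c' = (if \<forall>j'. (\<forall>p<k. j' p < n) \<and> val j \<le> val j' \<longrightarrow> T (seen j' n) then Acc else Rej)"
        using less.hyps[of j] rounds by auto
      have "reach ((n ^ k - val i) * round_time) (cfg (Check {}) 0 n (marks i) 0 0) c'"
        using reach_trans[OF round c'(1)] j(2) by (simp add: rounds)
      moreover have "(\<forall>j'. (\<forall>p<k. j' p < n) \<and> val j \<le> val j' \<longrightarrow> T (seen j' n)) \<longleftrightarrow>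
          (\<forall>j'. (\<forall>p<k. j' p < n) \<and> val i \<le> val j' \<longrightarrow> T (seen j' n))"
        using same unfolding j(2) by (metis Suc_eq_plus1 Suc_leD le_eq_less_or_eq less_eq_Suc_le)
      ultimately show ?thesis using c'(2) by (intro exI[of _ c']) simp
    qed
  qed
qed

text \<open>With L the input length, a round takes at most (3k + 4)(L + 1) steps and n^k is at most
  (L + 1)^k; the setup adds 2 to the coefficient. Using L + 1 also leaves time for the one step on
  the empty word.\<close>

lemma total_time:
  assumes "0 < n"
  shows "2 * n + 2 + n ^ k * round_time \<le> (3 * k + 6) * (n * Suc n + 1) ^ Suc k"
proof -
  define L where "L = n * Suc n"
  then have time: "round_time = 3 * L + n + 3 + k * (2 * n + 3)"
    by (simp add: round_time_def)
  have L: "n \<le> L" by (simp add: L_def)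
  then have "2 * n + 3 \<le> 3 * (L + 1)" by simp
  then have "k * (2 * n + 3) \<le> k * (3 * (L + 1))" by (rule mult_le_mono2)
  then have "round_time \<le> 3 * L + L + 3 + k * (3 * (L + 1))" using L time by linarith
  also have "\<dots> \<le> (3 * k + 4) * (L + 1)" by (simp add: algebra_simps)
  finally have "round_time \<le> (3 * k + 4) * (L + 1)" .
  moreover have "n ^ k \<le> (L + 1) ^ k" using L by (intro power_mono) linarith+
  ultimately have "n ^ k * round_time \<le> (L + 1) ^ k * ((3 * k + 4) * (L + 1))"
    by (intro mult_le_mono)
  moreover have "2 * n + 2 \<le> 2 * (L + 1) ^ Suc k"
  proof -
    have "L + 1 \<le> (L + 1) ^ Suc k" by (rule self_le_power) auto
    then show ?thesis using L by linarith
  qed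
  ultimately have "2 * n + 2 + n ^ k * round_time \<le>
      2 * (L + 1) ^ Suc k + (L + 1) ^ k * ((3 * k + 4) * (L + 1))"
    by linarith
  also have "\<dots> = (3 * k + 6) * (L + 1) ^ Suc k"
    by (simp only: power_Suc) algebra
  finally show ?thesis unfolding L_def .
qed

lemma machine_verdict:
  assumes "(3 * k + 6) * (n * Suc n + 1) ^ Suc k \<le> t"
  shows "fst (tm_run machine (matrix_word n A) t) =
    (if \<forall>i. (\<forall>p<k. i p < n) \<longrightarrow> T {(p, q). p < k \<and> q < k \<and> A (i p) (i q)} then accept machine
     else reject machine)"
proof -
  let ?c = "(Init0, [(W, 0), (\<lambda>_. 0, 0), (\<lambda>_. 0, 0)]) :: control \<times> tape list"
  let ?Q = "\<forall>i. (\<forall>p<k. i p < n) \<longrightarrow> T {(p, q). p < k \<and> q < k \<and> A (i p) (i q)}"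
  have "input_tape (matrix_word n A) = (W, 0)" by (simp add: W_def input_tape_def)
  then have init: "tm_init machine (matrix_word n A) = (num Init0, snd ?c)"
    by (simp add: tm_init_def machine_def numeral_2_eq_2)
  have "\<exists>c. reach t ?c c \<and> fst c = (if ?Q then Acc else Rej)"
  proof (cases "n = 0")
    case True
    then have "W 0 = 0" using W_blank(2) by simp
    then have "reach 1 ?c (Acc, [(W, 0), (\<lambda>_. 0, 0), (\<lambda>_. 0, 0)])"
      by (intro reach_step) (simp add: fun_upd_idem)
    moreover have "1 \<le> t" using assms True by simp
    \<comment> \<open>As k is positive, the empty graph has no k-tuples and accepting at once is
      correct.\<close>
    moreover have ?Q using k_pos True by auto
    ultimately show ?thesis using reach_mono by fastforce
  next
    case False
    then have n: "0 < n" by simp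
    have "val (\<lambda>_. 0) = 0" by (simp add: tuple_value_def)
    then obtain c where c: "reach (n ^ k * round_time) (cfg (Check {}) 0 n (marks (\<lambda>_. 0)) 0 0) c"
      "fst c = (if \<forall>j. (\<forall>p<k. j p < n) \<longrightarrow> T (seen j n) then Acc else Rej)"
      using reach_verdict[OF n, of "\<lambda>_. 0"] n by auto
    have "reach t ?c c"
      by (rule reach_mono[OF reach_trans[OF reach_initialised[OF n] c(1)]])
        (use total_time[OF n] assms in linarith)
    moreover have "seen j n = {(p, q). p < k \<and> q < k \<and> A (j p) (j q)}" if "\<forall>p<k. j p < n" for j
      using that by (auto simp: seen_def)
    then have "(\<forall>j. (\<forall>p<k. j p < n) \<longrightarrow> T (seen j n)) \<longleftrightarrow> ?Q" by simp
    ultimately show ?thesis using c(2) by (intro exI[of _ c]) simp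
  qed
  then obtain c where c: "reach t ?c c" "fst c = (if ?Q then Acc else Rej)" by blast
  have "(sstep ^^ t) ?c = c" using reach_halt[OF c(1)] c(2) by (auto split: if_splits)
  then have "fst (tm_run machine (matrix_word n A) t) = num (fst c)"
    using funpow_machine[OF start_and_halting_in_controls(1), of "snd ?c" t] by (simp add: tm_run_def init)
  moreover have "accept machine = num Acc" "reject machine = num Rej"
    by (simp_all add: machine_def)
  ultimately show ?thesis by (simp only: c(2) if_distrib[of num])
qed

end

section \<open>The recognition problem\<close>

instance letter :: finite
proof
  have "(UNIV :: letter set) = {ltr_a, ltr_b, ltr_c}"
    using letter.exhaust by auto
  then show "finite (UNIV :: letter set)" by (metis finite.emptyI finite_insert)
qed

lemma irrefl_cyclic_decoder: "irrefl cyclic_decoder"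
  by (auto simp: irrefl_def cyclic_decoder_def)

lemma adjacency_word_eq_matrix_word:
  "adjacency_word (G, vs) = matrix_word (length vs) (\<lambda>r c. (vs ! r, vs ! c) \<in> parcs G)"
proof -
  have map_index: "map f vs = map (\<lambda>r. f (vs ! r)) [0..<length vs]" for f :: "nat \<Rightarrow> 'b"
    using map_map[of f "(!) vs" "[0..<length vs]"] by (simp add: map_nth comp_def)
  show ?thesis
    unfolding matrix_word_def adjacency_word.simps
    by (subst map_index, subst map_index) simp
qed

lemma realizable_vertex_list:
  assumes "set vs = V"
  shows "realizable P V E \<longleftrightarrow> realizable P {..<length vs} (\<lambda>r c. E (vs ! r) (vs ! c))"
proof
  show "realizable P {..<length vs} (\<lambda>r c. E (vs ! r) (vs ! c))" if "realizable P V E"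
    by (rule realizable_pullback[OF that, where f = "(!) vs"]) (use assms nth_mem in auto)
  obtain f where f: "\<And>v. v \<in> V \<Longrightarrow> f v < length vs \<and> vs ! f v = v"
    using assms in_set_conv_nth[of _ vs] by metis
  show "realizable P V E" if "realizable P {..<length vs} (\<lambda>r c. E (vs ! r) (vs ! c))"
    by (rule realizable_pullback[OF that, where f = f]) (use f in auto)
qed

theorem theorem6:
  shows "polytime_decidable adjacency_word graph_presentations
    (\<lambda>(G, vs). \<exists>w :: letter list.
       digraph_iso (with_proj G) (with_proj (letter_graph cyclic_decoder w)))"
proof -
  obtain k where k: "0 < k" and tuples: "\<And>(V :: nat set) E. finite V \<Longrightarrow> irreflp E \<Longrightarrow> symp E \<Longrightarrow>
    realizable cyclic_decoder V E \<longleftrightarrow>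
    (\<forall>i. i ` {..<k} \<subseteq> V \<longrightarrow> realizable cyclic_decoder {..<k::nat} (\<lambda>p q. E (i p) (i q)))"
    using realizable_iff_tuples[OF irrefl_cyclic_decoder] by blast
  \<comment> \<open>Only subsets of \<open>{..<k} \<times> {..<k}\<close> occur as arguments, so
    this predicate enters the machine as a finite table.\<close>
  let ?T = "\<lambda>S. realizable cyclic_decoder {..<k} (\<lambda>p q. (p, q) \<in> S)"
  interpret tuple_machine k ?T by unfold_locales (rule k)
  \<comment> \<open>The bound of \<open>total_time\<close> as a polynomial in the input length:
    \<open>[:1, 1:]\<close> is X + 1.\<close>
  let ?p = "smult (3 * k + 6) ([:1, 1:] ^ Suc k) :: nat poly"
  have "set (adjacency_word (G, vs)) \<subseteq> {1..<symbols machine} \<and>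
      fst (tm_run machine (adjacency_word (G, vs)) (poly ?p (length (adjacency_word (G, vs))))) =
      (if \<exists>w. digraph_iso (with_proj G) (with_proj (letter_graph cyclic_decoder w))
       then accept machine else reject machine)"
    if "(G, vs) \<in> graph_presentations" for G :: "nat pair_pre_digraph" and vs
  proof -
    have G: "pair_graph G" and vs: "set vs = pverts G"
      using that by (auto simp: graph_presentations_def)
    interpret pair_graph G by (rule G)
    define n where "n = length vs"
    define A where "A r c \<longleftrightarrow> (vs ! r, vs ! c) \<in> parcs G" for r c
    interpret tuple_run k ?T n A by unfold_locales
    have word: "adjacency_word (G, vs) = matrix_word n A"
      unfolding n_def A_def by (rule adjacency_word_eq_matrix_word)
    have len: "length (matrix_word n A) = n * Suc n" by (simp add: matrix_word_eq)
    have A: "irreflp A" "symp A"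
      using no_loops arcs_symmetric by (fastforce simp: A_def irreflp_def symp_def)+
    have "(\<exists>w. digraph_iso (with_proj G) (with_proj (letter_graph cyclic_decoder w))) \<longleftrightarrow>
        realizable cyclic_decoder {..<n} A"
      unfolding realizable_iff_digraph_iso[OF G irrefl_cyclic_decoder] realizable_vertex_list[OF vs]
      by (simp add: n_def A_def [abs_def])
    also have "\<dots> \<longleftrightarrow> (\<forall>i. (\<forall>p<k. i p < n) \<longrightarrow> realizable cyclic_decoder {..<k} (\<lambda>p q. A (i p) (i q)))"
      unfolding tuples[OF finite_lessThan A] by (simp add: image_subset_iff Ball_def)
    \<comment> \<open>Realizability on \<open>{..<k}\<close> sees only pairs of indices below k,
      which is what the scan has collected.\<close>
    also have "\<dots> \<longleftrightarrow> (\<forall>i. (\<forall>p<k. i p < n) \<longrightarrow> ?T {(p, q). p < k \<and> q < k \<and> A (i p) (i q)})"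
      by (intro all_cong1 imp_cong refl realizable_cong) auto
    finally have verdict: "(\<exists>w. digraph_iso (with_proj G) (with_proj (letter_graph cyclic_decoder w))) \<longleftrightarrow>
      (\<forall>i. (\<forall>p<k. i p < n) \<longrightarrow> ?T {(p, q). p < k \<and> q < k \<and> A (i p) (i q)})" .
    have "set (matrix_word n A) \<subseteq> {1..<symbols machine}"
      by (auto simp: matrix_word_def machine_def)
    moreover have time: "poly ?p (n * Suc n) = (3 * k + 6) * (n * Suc n + 1) ^ Suc k"
      by (simp add: poly_power algebra_simps)
    ultimately show ?thesis
      unfolding word len verdict by (intro conjI machine_verdict) (simp_all only: time order_refl)
  qed
  then have "\<forall>x\<in>graph_presentations. set (adjacency_word x) \<subseteq> {1..<symbols machine} \<and>
      fst (tm_run machine (adjacency_word x) (poly ?p (length (adjacency_word x)))) =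
      (if case x of (G, vs) \<Rightarrow> \<exists>w. digraph_iso (with_proj G) (with_proj (letter_graph cyclic_decoder w))
       then accept machine else reject machine)"
    by (intro ballI, split prod.split) blast
  with wf_machine show ?thesis
    unfolding polytime_decidable_def by blast
qed

end
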